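(* The $A_\infty$ morphism $\pi_\infty:\Omega^*([0,1])\to C^*_\infty([0,1])$ obtained from homological perturbation theory (homotopy transfer along Dupont's contraction) coincides with the $C_\infty$ morphism $\varphi=\log\circ\lambda:\Omega^*([0,1])\to C^*_\infty([0,1])$.
   Context: **$A_\infty$ conventions.** $\Bbbk$ is a field of characteristic zero. For a graded vector space $V$, $\mathbf{s}V$ is the suspension, $(\mathbf{s}V)^i=V^{i+1}$. $\overline{T}(V)=\bigoplus_{n\ge1}T^n(V)$, $T^n(V)=V^{\otimes n}$, carries the deconcatenation coproduct. An $A_\infty$ algebra structure on $V$ is a degree $1$ coderivation $Q$ of $\overline{T}(\mathbf{s}V)$ with $Q^2=0$; it is determined by its Taylor coefficients $Q_n:(\mathbf{s}V)^{\otimes n}\to\mathbf{s}V$. An $A_\infty$ morphism $F:V\to W$ is a morphism of dg coalgebras $\overline{T}(\mathbf{s}V)\to\overline{T}(\mathbf{s}W)$, determined by its Taylor coefficients $F_n:(\mathbf{s}V)^{\otimes n}\to\mathbf{s}W$; the composition has coefficients $(G\circ F)_n=\sum_{k}\sum_{i_1+\cdots+i_k=n}G_k(F_{i_1}\otimes\cdots\otimes F_{i_k})$. A dg algebra is an $A_\infty$ algebra via $Q_1(\mathbf{s}a)=-\mathbf{s}(da)$, $Q_2(\mathbf{s}a\otimes\mathbf{s}b)=(-1)^{|a|}\mathbf{s}(ab)$, $Q_n=0$ for $n\ge3$. The Koszul sign rule applies to tensor products of maps. $C_\infty$ morphisms are $A_\infty$ morphisms whose Taylor coefficients vanish on shuffle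 products. **Forms and cochains.** $\Omega^*([0,1])$ is either the commutative dg algebra of smooth real forms on $[0,1]$ ($\Bbbk=\mathbb{R}$) or that of polynomial forms $\Bbbk[t]\oplus\Bbbk[t]dt$ (with polynomial integrals evaluated formally). $C^*([0,1])\subset\Omega^*([0,1])$ is the subcomplex of Whitney forms $\{at+b(1-t)\}\oplus\{c\,dt\}$, $a,b,c\in\Bbbk$. $C^*_\cup([0,1])$ is the dg algebra $(C^*([0,1]),d,\cup)$ with unit the constant function $1$ and $t\cup t=t$, $t\cup dt=0$, $dt\cup t=dt$. $C^*_\infty([0,1])$ is $C^*([0,1])$ with the $C_\infty$ structure, unital with respect to $1$, with Taylor coefficients: $m_1(\mathbf{s}t)=-\mathbf{s}dt$, $m_2(\mathbf{s}t\otimes\mathbf{s}t)=\mathbf{s}t$, $m_2(\mathbf{s}t\otimes\mathbf{s}dt)=\frac12\mathbf{s}dt=-m_2(\mathbf{s}dt\otimes\mathbf{s}t)$, and for $n>1$, $m_{n+1}$ vanishes unless precisely one argument is a function, with $m_{n+1}((\mathbf{s}dt)^{\otimes i}\otimes\mathbf{s}t\otimes(\mathbf{s}dt)^{\otimes n-i})=(-1)^{i+1}\binom{n}{i}\frac{B_n}{n!}\mathbf{s}dt$, where $\frac{z}{e^z-1}=\sum_{n\ge0}\frac{B_n}{n!}z^n$. It is the structure obtained from $\Omega^*([0,1])$ by homotopy transfer along Dupont's contraction. **Dupont's contraction** consists of the inclusion $\iota:C^*([0,1])\to\Omega^*([0,1])$, the chain map $\pi:\Omega^*([0,1])\to C^*([0,1])$,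 $\pi(f)=f(1)t+f(0)(1-t)$, $\pi(a(t)dt)=\left(\int_0^1a(\tau)d\tau\right)dt$, and the homotopy $h:\Omega^1([0,1])\to\Omega^0([0,1])$, $h(a(t)dt)=t\int_0^1a(\tau)d\tau-\int_0^ta(\tau)d\tau$ (zero on functions). **The transferred morphism $\pi_\infty$** is the $A_\infty$ morphism $\Omega^*([0,1])\to C^*_\infty([0,1])$ whose Taylor coefficients $\pi_n$ are given by the usual perturbation formulas: $\pi_1=\pi$ and $\pi_n=\pi_{n-1}Q^{n-1}_nH^n_n$ for $n\ge2$, where $Q^{n-1}_n=\sum_{i=0}^{n-2}\mathrm{id}^{\otimes i}\otimes Q_2\otimes\mathrm{id}^{\otimes n-i-2}$ and $H^n_n=\sum_{i=0}^{n-1}\mathrm{id}^{\otimes i}\otimes(-h)\otimes(\iota\pi)^{\otimes n-i-1}$ on $T^n(\mathbf{s}\Omega^*([0,1]))$, with $Q_2$ the quadratic part of the codifferential of $\Omega^*([0,1])$, and $-h$, $\iota\pi$ acting on $\mathbf{s}\Omega^*([0,1])$ by $\mathbf{s}x\mapsto-\mathbf{s}h(x)$, $\mathbf{s}x\mapsto\mathbf{s}\iota\pi(x)$. **The morphism $\lambda$** is the $A_\infty$ morphism $\Omega^*([0,1])\to C^*_\cup([0,1])$ with $\lambda_1=\pi$; for $n>1$, $\lambda_n$ vanishes if some factor is a zero-form; and $\lambda_n(\mathbf{s}a_1(t)dt\otimes\cdots\otimes\mathbf{s}a_n(t)dt)=\left(\int_{0\le t_1\le\cdots\le t_n\le1}a_1(t_1)\cdots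 a_n(t_n)dt_1\cdots dt_n\right)\mathbf{s}dt$ for $n\ge1$. **The morphism $\log$** is the $A_\infty$ isomorphism $C^*_\cup([0,1])\to C^*_\infty([0,1])$ with $\log_1=\mathrm{id}$, $\log_n$ ($n>1$) vanishing if some factor is a zero-form, and $\log_n((\mathbf{s}dt)^{\otimes n})=\frac{(-1)^{n+1}}{n}\mathbf{s}dt$ for $n\ge1$. *)

theory Defs
  imports "HOL-Analysis.Analysis" "HOL-Computational_Algebra.Computational_Algebra"
begin

section \<open>\<open>A\<^sub>\<infinity>\<close> and \<open>C\<^sub>\<infinity>\<close> morphisms between complexes in degrees 0 and 1\<close>

text \<open>
  All graded spaces that occur are concentrated in degrees 0 and 1. Such a space is a type
  \<open>'a \<times> 'b\<close>, where \<open>(u, v)\<close> is the sum of the degree 0 element \<open>u\<close> and the degree 1 element \<open>v\<close>.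
  In the suspension \<open>sV\<close> these have degrees \<open>-1\<close> and \<open>0\<close>.

  A linear map out of \<open>T\<^sup>n(sV)\<close> is represented by the corresponding \<open>n\<close>-linear map, and a family
  \<open>F\<^sub>1, F\<^sub>2, \<dots>\<close> of Taylor coefficients by one function on lists:
  \<open>F [x\<^sub>1, \<dots>, x\<^sub>n] = F\<^sub>n (sx\<^sub>1 \<otimes> \<dots> \<otimes> sx\<^sub>n)\<close>, both sides read in the unsuspended target.
  The value on the empty list is irrelevant.
\<close>

definition susp_part :: "int \<Rightarrow> ('a::zero \<times> 'b::zero) set" where
  "susp_part d = (if d = - 1 then {x. snd x = 0} else if d = 0 then {x. fst x = 0} else {0})"

text \<open>
  The linear involution \<open>sx \<mapsto> (-1)\<^bsup>|sx|\<^esup> sx\<close>. By the Koszul rule, for a map \<open>P\<close> of odd degree,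
  \<open>(id\<^bsup>\<otimes>i\<^esup> \<otimes> P \<otimes> \<dots>) (x\<^sub>1 \<otimes> \<dots> \<otimes> x\<^sub>n) = koszul x\<^sub>1 \<otimes> \<dots> \<otimes> koszul x\<^sub>i \<otimes> P (x\<^bsub>i+1\<^esub> \<otimes> \<dots>) \<otimes> \<dots>\<close>,
  also for inhomogeneous \<open>x\<^sub>j\<close>.
\<close>

definition koszul :: "'a::uminus \<times> 'b \<Rightarrow> 'a \<times> 'b" where
  "koszul x = (- fst x, snd x)"

record ('k, 'v) A_infinity =
  smul :: "'k \<Rightarrow> 'v \<Rightarrow> 'v"
  taylor :: "'v list \<Rightarrow> 'v"

definition multilinear ::
    "('k::field \<Rightarrow> 'v::ab_group_add \<Rightarrow> 'v) \<Rightarrow> ('k \<Rightarrow> 'w::ab_group_add \<Rightarrow> 'w) \<Rightarrow> ('v list \<Rightarrow> 'w) \<Rightarrow> bool"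
  where "multilinear s s' F \<longleftrightarrow> (\<forall>us ws. Vector_Spaces.linear s s' (\<lambda>x. F (us @ x # ws)))"

definition degree_zero :: "(('a::zero \<times> 'b::zero) list \<Rightarrow> 'c::zero \<times> 'd::zero) \<Rightarrow> bool" where
  "degree_zero F \<longleftrightarrow>
     (\<forall>xs ds. xs \<noteq> [] \<longrightarrow> list_all2 (\<lambda>x d. x \<in> susp_part d) xs ds \<longrightarrow> F xs \<in> susp_part (sum_list ds))"

text \<open>The ways of cutting a word into consecutive nonempty blocks, and of singling out one such block.\<close>

definition blocks :: "'v list \<Rightarrow> 'v list list set" where
  "blocks xs = {yss. concat yss = xs \<and> [] \<notin> set yss}"

definition subblocks :: "'v list \<Rightarrow> ('v list \<times> 'v list \<times> 'v list) set" where
  "subblocks xs = {(us, vs, ws). us @ vs @ ws = xs \<and> vs \<noteq> []}"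

definition A_inf_compose :: "('w list \<Rightarrow> 'u::comm_monoid_add) \<Rightarrow> ('v list \<Rightarrow> 'w) \<Rightarrow> 'v list \<Rightarrow> 'u" where
  "A_inf_compose G F xs = (\<Sum>yss\<in>blocks xs. G (map F yss))"

text \<open>
  A morphism of graded coalgebras commutes with the codifferentials iff the corestrictions
  of the two composites agree; these are the two sides of the equation below.
\<close>

definition A_infinity_morphism ::
    "('k::field, 'a::ab_group_add \<times> 'b::ab_group_add) A_infinity \<Rightarrow>
     ('k, 'c::ab_group_add \<times> 'd::ab_group_add) A_infinity \<Rightarrow> (('a \<times> 'b) list \<Rightarrow> 'c \<times> 'd) \<Rightarrow> bool" where
  "A_infinity_morphism V W F \<longleftrightarrow>
     multilinear (smul V) (smul W) F \<and> degree_zero F \<and>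
     (\<forall>xs. xs \<noteq> [] \<longrightarrow>
        (\<Sum>(us, vs, ws)\<in>subblocks xs. F (map koszul us @ taylor V vs # ws)) =
        A_inf_compose (taylor W) F xs)"

text \<open>
  \<open>shuffle_sum F xs ys\<close> is \<open>F\<close> applied to the signed shuffle product, on \<open>T(sV)\<close>, of the words
  \<open>xs\<close> and \<open>ys\<close> with homogeneous letters. The odd elements of \<open>sV\<close> are those of degree 0 in \<open>V\<close>.
\<close>

definition susp_odd :: "'a::zero \<times> 'b \<Rightarrow> bool" where
  "susp_odd x \<longleftrightarrow> fst x \<noteq> 0"

fun shuffle_sum :: "(('a::zero \<times> 'b) list \<Rightarrow> 'w::ab_group_add) \<Rightarrow> ('a \<times> 'b) list \<Rightarrow> ('a \<times> 'b) list \<Rightarrow> 'w"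
  where
    "shuffle_sum F [] ys = F ys"
  | "shuffle_sum F (x # xs) [] = F (x # xs)"
  | "shuffle_sum F (x # xs) (y # ys) =
       shuffle_sum (\<lambda>zs. F (x # zs)) xs (y # ys) +
       (if susp_odd y \<and> odd (length (filter susp_odd (x # xs)))
        then - shuffle_sum (\<lambda>zs. F (y # zs)) (x # xs) ys
        else shuffle_sum (\<lambda>zs. F (y # zs)) (x # xs) ys)"

definition C_infinity_morphism ::
    "('k::field, 'a::ab_group_add \<times> 'b::ab_group_add) A_infinity \<Rightarrow>
     ('k, 'c::ab_group_add \<times> 'd::ab_group_add) A_infinity \<Rightarrow> (('a \<times> 'b) list \<Rightarrow> 'c \<times> 'd) \<Rightarrow> bool" where
  "C_infinity_morphism V W F \<longleftrightarrow>
     A_infinity_morphism V W F \<and>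
     (\<forall>xs ys. xs \<noteq> [] \<longrightarrow> ys \<noteq> [] \<longrightarrow> (\<forall>z\<in>set (xs @ ys). fst z = 0 \<or> snd z = 0) \<longrightarrow>
        shuffle_sum F xs ys = 0)"


section \<open>Smooth and polynomial forms on the interval\<close>

text \<open>
  What is used about functions on the interval: \<open>primitive a\<close> is \<open>t \<mapsto> \<integral>\<^sub>0\<^sup>t a\<close>, and
  \<open>simplex_int [a\<^sub>1, \<dots>, a\<^sub>n]\<close> is the integral of \<open>a\<^sub>1(t\<^sub>1) \<dots> a\<^sub>n(t\<^sub>n)\<close> over \<open>0 \<le> t\<^sub>1 \<le> \<dots> \<le> t\<^sub>n \<le> 1\<close>.
\<close>

record ('k, 'f) interval_functions =
  scale_fn :: "'k \<Rightarrow> 'f \<Rightarrow> 'f"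
  eval_fn :: "'f \<Rightarrow> 'k \<Rightarrow> 'k"
  coord :: 'f
  deriv_fn :: "'f \<Rightarrow> 'f"
  primitive :: "'f \<Rightarrow> 'f"
  simplex_int :: "'f list \<Rightarrow> 'k"

subsection \<open>Polynomials\<close>

definition poly_primitive :: "'k::field_char_0 poly \<Rightarrow> 'k poly" where
  "poly_primitive p = (\<Sum>i\<le>degree p. monom (coeff p i / of_nat (Suc i)) (Suc i))"

text \<open>The formal integral over the simplex is evaluated by integrating over \<open>t\<^sub>1\<close> first.\<close>

definition poly_functions :: "('k::field_char_0, 'k poly) interval_functions" where
  "poly_functions =
     \<lparr>scale_fn = smult, eval_fn = poly, coord = [:0, 1:], deriv_fn = pderiv,
      primitive = poly_primitive,
      simplex_int = (\<lambda>as. poly (foldl (\<lambda>g a. poly_primitive (a * g)) 1 as) 1)\<rparr>"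

subsection \<open>Smooth functions\<close>

text \<open>Functions on the unit interval are represented by their extension by 0 to the real line.\<close>

definition deriv01 :: "(real \<Rightarrow> real) \<Rightarrow> real \<Rightarrow> real" where
  "deriv01 f x = (if x \<in> {0..1} then vector_derivative f (at x within {0..1}) else 0)"

definition smooth01 :: "(real \<Rightarrow> real) \<Rightarrow> bool" where
  "smooth01 f \<longleftrightarrow> (\<forall>x. x \<notin> {0..1} \<longrightarrow> f x = 0) \<and>
     (\<forall>n. \<forall>x\<in>{0..1}. ((deriv01 ^^ n) f) differentiable (at x within {0..1}))"

lemma deriv01_eqI:
  assumes "\<And>x. x \<in> {0..1} \<Longrightarrow> (f has_real_derivative f' x) (at x within {0..1})"
    and "\<And>x. x \<notin> {0..1} \<Longrightarrow> f' x = 0"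
  shows "deriv01 f = f'"
proof
  fix x
  show "deriv01 f x = f' x"
  proof (cases "x \<in> {0..1}")
    case True
    then have "(f has_vector_derivative f' x) (at x within {0..1})"
      using assms(1) by (simp add: has_real_derivative_iff_has_vector_derivative)
    then show ?thesis
      using True vector_derivative_within_cbox[of 0 1 x f "f' x"] by (simp add: deriv01_def)
  next
    case False
    then show ?thesis using assms(2)[OF False] by (auto simp: deriv01_def)
  qed
qed

lemma smooth01_outside: "smooth01 f \<Longrightarrow> x \<notin> {0..1} \<Longrightarrow> f x = 0"
  by (simp add: smooth01_def)

lemma smooth01_has_derivative:
  assumes "smooth01 f" "x \<in> {0..1}"
  shows "(f has_real_derivative deriv01 f x) (at x within {0..1})"
proof -
  have "((deriv01 ^^ 0) f) differentiable (at x within {0..1})"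
    using assms unfolding smooth01_def by blast
  then have "(f has_vector_derivative vector_derivative f (at x within {0..1})) (at x within {0..1})"
    by (simp add: vector_derivative_works)
  then show ?thesis
    using assms(2) by (simp add: deriv01_def has_real_derivative_iff_has_vector_derivative)
qed

lemma smooth01_deriv: "smooth01 f \<Longrightarrow> smooth01 (deriv01 f)"
  unfolding smooth01_def
  by (metis deriv01_def funpow_Suc_right o_apply)

lemma smooth01_coinduct:
  assumes "P f"
    and out: "\<And>g x. P g \<Longrightarrow> x \<notin> {0..1} \<Longrightarrow> g x = 0"
    and step: "\<And>g. P g \<Longrightarrow>
      \<exists>g'. P g' \<and> (\<forall>x\<in>{0..1}. (g has_real_derivative g' x) (at x within {0..1}))"
  shows "smooth01 f"
proof -
  have D: "P (deriv01 g)" if "P g" for g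
    using step[OF that] out deriv01_eqI[of g] by metis
  have P: "P ((deriv01 ^^ n) f)" for n
    by (induction n) (use assms(1) D in auto)
  have "g differentiable (at x within {0..1})" if "P g" "x \<in> {0..1}" for g x
    using step[OF that(1)] that(2)
    by (meson field_differentiable_def field_differentiable_imp_differentiable)
  then show ?thesis
    unfolding smooth01_def using P out[OF assms(1)] by blast
qed

lemma smooth01_intro:
  assumes "\<And>x. x \<in> {0..1} \<Longrightarrow> (f has_real_derivative f' x) (at x within {0..1})"
    and "\<And>x. x \<notin> {0..1} \<Longrightarrow> f x = 0" "smooth01 f'"
  shows "smooth01 f"
proof (rule smooth01_coinduct[where P = "\<lambda>g. g = f \<or> smooth01 g"])
  fix g assume "g = f \<or> smooth01 g"
  then show "\<exists>g'. (g' = f \<or> smooth01 g') \<and>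
      (\<forall>x\<in>{0..1}. (g has_real_derivative g' x) (at x within {0..1}))"
    using assms smooth01_has_derivative smooth01_deriv by metis
qed (use assms smooth01_outside in auto)

inductive smooth_ring :: "(real \<Rightarrow> real) \<Rightarrow> bool" where
  base: "smooth01 f \<Longrightarrow> smooth_ring f"
| add: "smooth_ring f \<Longrightarrow> smooth_ring g \<Longrightarrow> smooth_ring (\<lambda>x. f x + g x)"
| mult: "smooth_ring f \<Longrightarrow> smooth_ring g \<Longrightarrow> smooth_ring (\<lambda>x. f x * g x)"

lemma smooth_ring_smooth01:
  assumes "smooth_ring f"
  shows "smooth01 f"
proof (rule smooth01_coinduct[where P = smooth_ring, OF assms])
  show "g x = 0" if "smooth_ring g" "x \<notin> {0..1}" for g x
    using that by (induction) (use smooth01_outside in auto)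
next
  fix g assume "smooth_ring g"
  then show "\<exists>g'. smooth_ring g' \<and> (\<forall>x\<in>{0..1}. (g has_real_derivative g' x) (at x within {0..1}))"
  proof induction
    case (base f)
    then show ?case
      using smooth01_has_derivative smooth01_deriv smooth_ring.base by blast
  next
    case (add f g)
    then obtain f' g' where
      "smooth_ring f'" "\<forall>x\<in>{0..1}. (f has_real_derivative f' x) (at x within {0..1})"
      "smooth_ring g'" "\<forall>x\<in>{0..1}. (g has_real_derivative g' x) (at x within {0..1})"
      by blast
    then show ?case
      by (intro exI[of _ "\<lambda>x. f' x + g' x"]) (auto intro: smooth_ring.add DERIV_add)
  next
    case (mult f g)
    then obtain f' g' where
      *: "smooth_ring f'" "\<forall>x\<in>{0..1}. (f has_real_derivative f' x) (at x within {0..1})"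
      "smooth_ring g'" "\<forall>x\<in>{0..1}. (g has_real_derivative g' x) (at x within {0..1})"
      by blast
    have "smooth_ring (\<lambda>x. f' x * g x + g' x * f x)"
      using * mult.hyps by (intro smooth_ring.add smooth_ring.mult)
    moreover have "((\<lambda>x. f x * g x) has_real_derivative f' x * g x + g' x * f x) (at x within {0..1})"
      if "x \<in> {0..1}" for x
      using * that by (intro DERIV_mult) auto
    ultimately show ?case by (intro exI[of _ "\<lambda>x. f' x * g x + g' x * f x"]) auto
  qed
qed

lemma smooth01_add: "smooth01 f \<Longrightarrow> smooth01 g \<Longrightarrow> smooth01 (\<lambda>x. f x + g x)"
  and smooth01_mult: "smooth01 f \<Longrightarrow> smooth01 g \<Longrightarrow> smooth01 (\<lambda>x. f x * g x)"
  by (auto intro: smooth_ring_smooth01 smooth_ring.intros)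

lemma smooth01_zero: "smooth01 (\<lambda>x. 0)"
  by (rule smooth01_coinduct[where P = "\<lambda>g. g = (\<lambda>x. 0)"]) auto

lemma smooth01_indicator: "smooth01 (indicator {0..1})"
proof (rule smooth01_intro)
  fix x :: real assume x: "x \<in> {0..1}"
  have "((\<lambda>_. 1 :: real) has_real_derivative 0) (at x within {0..1})" by simp
  then show "(indicator {0..1} has_real_derivative 0) (at x within {0..1})"
    by (rule has_field_derivative_transform_within[where d = 1]) (use x in auto)
qed (auto simp: smooth01_zero)

lemma smooth01_scale:
  assumes "smooth01 f"
  shows "smooth01 (\<lambda>x. c * f x)"
proof (rule smooth01_coinduct[where P = "\<lambda>g. \<exists>f. smooth01 f \<and> g = (\<lambda>x. c * f x)"])
  fix g assume "\<exists>f. smooth01 f \<and> g = (\<lambda>x. c * f x)"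
  then obtain f where f: "smooth01 f" "g = (\<lambda>x. c * f x)" by blast
  then show "\<exists>g'. (\<exists>f. smooth01 f \<and> g' = (\<lambda>x. c * f x)) \<and>
      (\<forall>x\<in>{0..1}. (g has_real_derivative g' x) (at x within {0..1}))"
    using smooth01_deriv[of f] smooth01_has_derivative[of f]
    by (intro exI[of _ "\<lambda>x. c * deriv01 f x"]) (auto intro!: DERIV_cmult)
qed (use assms smooth01_outside in auto)

lemma smooth01_coord: "smooth01 (\<lambda>x. indicator {0..1} x * x)"
proof (rule smooth01_intro)
  fix x :: real assume x: "x \<in> {0..1}"
  have "((\<lambda>x. x) has_real_derivative indicator {0..1} x) (at x within {0..1})"
    using x by simp
  then show "((\<lambda>x. indicator {0..1} x * x) has_real_derivative indicator {0..1} x) (at x within {0..1})"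
    by (rule has_field_derivative_transform_within[where d = 1]) (use x in auto)
qed (auto simp: smooth01_indicator)

lemma smooth01_primitive:
  assumes "smooth01 f"
  shows "smooth01 (\<lambda>x. indicator {0..1} x * integral {0..x} f)"
proof (rule smooth01_intro)
  fix x :: real assume x: "x \<in> {0..1}"
  have "continuous_on {0..1} f"
    using smooth01_has_derivative[OF assms] DERIV_continuous_on by blast
  then have "((\<lambda>x. integral {0..x} f) has_real_derivative f x) (at x within {0..1})"
    using x by (rule integral_has_real_derivative)
  then show "((\<lambda>x. indicator {0..1} x * integral {0..x} f) has_real_derivative f x) (at x within {0..1})"
    by (rule has_field_derivative_transform_within[where d = 1]) (use x in auto)
qed (auto simp: assms)

typedef smooth_fn = "{f. smooth01 f}"
  morphisms smooth_eval Smooth_fn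
  using smooth01_zero by auto

setup_lifting type_definition_smooth_fn

instantiation smooth_fn :: comm_ring_1
begin

lift_definition zero_smooth_fn :: smooth_fn is "\<lambda>x. 0"
  by (rule smooth01_zero)

lift_definition one_smooth_fn :: smooth_fn is "indicator {0..1}"
  by (rule smooth01_indicator)

lift_definition plus_smooth_fn :: "smooth_fn \<Rightarrow> smooth_fn \<Rightarrow> smooth_fn" is "\<lambda>f g x. f x + g x"
  by (rule smooth01_add)

lift_definition times_smooth_fn :: "smooth_fn \<Rightarrow> smooth_fn \<Rightarrow> smooth_fn" is "\<lambda>f g x. f x * g x"
  by (rule smooth01_mult)

lift_definition uminus_smooth_fn :: "smooth_fn \<Rightarrow> smooth_fn" is "\<lambda>f x. - f x"
  using smooth01_scale[of _ "- 1"] by simp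

definition minus_smooth_fn :: "smooth_fn \<Rightarrow> smooth_fn \<Rightarrow> smooth_fn" where
  "minus_smooth_fn f g = f + - g"

instance
proof
  fix a b c :: smooth_fn
  show "a + b + c = a + (b + c)" by transfer (simp add: add.assoc)
  show "a + b = b + a" by transfer (simp add: add.commute)
  show "0 + a = a" by transfer simp
  show "- a + a = 0" by transfer simp
  show "a - b = a + - b" by (simp add: minus_smooth_fn_def)
  show "a * b * c = a * (b * c)" by transfer (simp add: mult.assoc)
  show "a * b = b * a" by transfer (simp add: mult.commute)
  show "1 * a = a"
    by transfer (auto simp: fun_eq_iff indicator_def dest: smooth01_outside)
  show "(a + b) * c = a * c + b * c" by transfer (simp add: distrib_right)
  show "(0 :: smooth_fn) \<noteq> 1"
    by transfer (auto simp: fun_eq_iff indicator_def intro!: exI[of _ 0])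
qed

end

lift_definition smooth_scale :: "real \<Rightarrow> smooth_fn \<Rightarrow> smooth_fn" is "\<lambda>c f x. c * f x"
  by (rule smooth01_scale)

lift_definition smooth_coord :: smooth_fn is "\<lambda>x. indicator {0..1} x * x"
  by (rule smooth01_coord)

lift_definition smooth_deriv :: "smooth_fn \<Rightarrow> smooth_fn" is deriv01
  by (rule smooth01_deriv)

lift_definition smooth_primitive :: "smooth_fn \<Rightarrow> smooth_fn" is
  "\<lambda>f x. indicator {0..1} x * integral {0..x} f"
  by (rule smooth01_primitive)

definition smooth_simplex_int :: "smooth_fn list \<Rightarrow> real" where
  "smooth_simplex_int as =
     (let n = length as;
          \<Delta> = {\<tau>. (\<forall>i<n. 0 \<le> \<tau> i \<and> \<tau> i \<le> 1) \<and> (\<forall>i j. i < j \<and> j < n \<longrightarrow> \<tau> i \<le> \<tau> j)}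
      in LINT \<tau>|Pi\<^sub>M {..<n} (\<lambda>_. lborel).
           indicator \<Delta> \<tau> * (\<Prod>i<n. smooth_eval (as ! i) (\<tau> i)))"

definition smooth_functions :: "(real, smooth_fn) interval_functions" where
  "smooth_functions =
     \<lparr>scale_fn = smooth_scale, eval_fn = smooth_eval, coord = smooth_coord,
      deriv_fn = smooth_deriv, primitive = smooth_primitive, simplex_int = smooth_simplex_int\<rparr>"

subsection \<open>The dg algebra of forms\<close>

text \<open>The pair \<open>(f, a)\<close> is the form \<open>f + a dt\<close>.\<close>

definition form_diff :: "('k, 'f::comm_ring_1) interval_functions \<Rightarrow> 'f \<times> 'f \<Rightarrow> 'f \<times> 'f" where
  "form_diff M x = (0, deriv_fn M (fst x))"

definition form_mult :: "'f::comm_ring_1 \<times> 'f \<Rightarrow> 'f \<times> 'f \<Rightarrow> 'f \<times> 'f" where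
  "form_mult x y = (fst x * fst y, fst x * snd y + snd x * fst y)"

text \<open>\<open>Q\<^sub>2(sa \<otimes> sb) = (-1)\<^bsup>|a|\<^esup> s(ab)\<close>, and \<open>(-1)\<^bsup>|a|\<^esup> = - (-1)\<^bsup>|sa|\<^esup>\<close>.\<close>

definition Omega_Q2 :: "'f::comm_ring_1 \<times> 'f \<Rightarrow> 'f \<times> 'f \<Rightarrow> 'f \<times> 'f" where
  "Omega_Q2 x y = form_mult (- koszul x) y"

definition Omega :: "('k, 'f::comm_ring_1) interval_functions \<Rightarrow> ('k, 'f \<times> 'f) A_infinity" where
  "Omega M =
     \<lparr>smul = (\<lambda>c x. (scale_fn M c (fst x), scale_fn M c (snd x))),
      taylor = (\<lambda>xs. case xs of [x] \<Rightarrow> - form_diff M x | [x, y] \<Rightarrow> Omega_Q2 x y | _ \<Rightarrow> 0)\<rparr>"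


section \<open>Whitney forms and Dupont's contraction\<close>

text \<open>The triple \<open>((a, b), c)\<close> is the Whitney form \<open>a t + b (1 - t) + c dt\<close>.\<close>

type_synonym 'k whitney = "('k \<times> 'k) \<times> 'k"

definition iota :: "('k, 'f::comm_ring_1) interval_functions \<Rightarrow> 'k whitney \<Rightarrow> 'f \<times> 'f" where
  "iota M = (\<lambda>((a, b), c).
     (scale_fn M a (coord M) + scale_fn M b (1 - coord M), scale_fn M c 1))"

definition integral01 :: "('k::one, 'f) interval_functions \<Rightarrow> 'f \<Rightarrow> 'k" where
  "integral01 M a = eval_fn M (primitive M a) 1"

definition dupont_pi :: "('k::zero_neq_one, 'f) interval_functions \<Rightarrow> 'f \<times> 'f \<Rightarrow> 'k whitney" where
  "dupont_pi M = (\<lambda>(f, a). ((eval_fn M f 1, eval_fn M f 0), integral01 M a))"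

definition dupont_h :: "('k::one, 'f::comm_ring_1) interval_functions \<Rightarrow> 'f \<times> 'f \<Rightarrow> 'f \<times> 'f" where
  "dupont_h M = (\<lambda>(f, a). (scale_fn M (integral01 M a) (coord M) - primitive M a, 0))"

text \<open>\<open>bernoulli n\<close> is \<open>B\<^sub>n\<close> with \<open>\<Sum>n. B\<^sub>n / n! z\<^sup>n = z / (e\<^sup>z - 1)\<close>, so \<open>B\<^sub>1 = - 1/2\<close>.\<close>

definition bernoulli :: "nat \<Rightarrow> 'k::field_char_0" where
  "bernoulli n = fact n * fps_nth (fps_X / (fps_exp 1 - 1)) n"

text \<open>
  \<open>m\<^sub>2\<close> is determined by its values on \<open>t\<close>, \<open>dt\<close> and the unit 1. For \<open>n > 1\<close>, \<open>m\<^bsub>n+1\<^esub>\<close> vanishes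
  when the unit is inserted, so the function \<open>a t + b (1 - t) = b 1 + (a - b) t\<close> contributes
  through its coefficient \<open>a - b\<close>; the summand \<open>i\<close> is the term with the function in position \<open>i\<close>.
\<close>

definition C_inf_taylor :: "'k::field_char_0 whitney list \<Rightarrow> 'k whitney" where
  "C_inf_taylor ws =
     (case ws of
        [] \<Rightarrow> 0
      | [((a, b), c)] \<Rightarrow> (0, - (a - b))
      | [((a, b), c), ((a', b'), c')] \<Rightarrow>
          ((a * a', b * b'), (b + (a - b) / 2) * c' - c * (b' + (a' - b') / 2))
      | _ \<Rightarrow>
          let n = length ws - 1 in
          (0, \<Sum>i\<le>n. (- 1) ^ (i + 1) * of_nat (n choose i) * bernoulli n / fact n *
                 (fst (fst (ws ! i)) - snd (fst (ws ! i))) * (\<Prod>j\<in>{..n} - {i}. snd (ws ! j))))"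

definition C_inf :: "('k::field_char_0, 'k whitney) A_infinity" where
  "C_inf =
     \<lparr>smul = (\<lambda>r ((a, b), c). ((r * a, r * b), r * c)), taylor = C_inf_taylor\<rparr>"


section \<open>The morphisms\<close>

subsection \<open>The transferred morphism\<close>

text \<open>Precomposition of a map on \<open>T\<^bsup>n-1\<^esup>(s\<Omega>)\<close> with \<open>Q\<^sub>n\<^bsup>n-1\<^esup>\<close>, and of a map on \<open>T\<^sup>n(s\<Omega>)\<close> with \<open>H\<^sub>n\<^sup>n\<close>.\<close>

definition precomp_Q ::
    "(('f::comm_ring_1 \<times> 'f) list \<Rightarrow> 'w::comm_monoid_add) \<Rightarrow> ('f \<times> 'f) list \<Rightarrow> 'w" where
  "precomp_Q F xs =
     (\<Sum>i<length xs - 1.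
        F (map koszul (take i xs) @ Omega_Q2 (xs ! i) (xs ! Suc i) # drop (i + 2) xs))"

definition precomp_H ::
    "('k::zero_neq_one, 'f::comm_ring_1) interval_functions \<Rightarrow>
     (('f \<times> 'f) list \<Rightarrow> 'w::comm_monoid_add) \<Rightarrow> ('f \<times> 'f) list \<Rightarrow> 'w" where
  "precomp_H M F xs =
     (\<Sum>i<length xs.
        F (map koszul (take i xs) @ (- dupont_h M (xs ! i)) #
           map (iota M \<circ> dupont_pi M) (drop (Suc i) xs)))"

fun pi_coeff ::
    "('k::field_char_0, 'f::comm_ring_1) interval_functions \<Rightarrow> nat \<Rightarrow> ('f \<times> 'f) list \<Rightarrow> 'k whitney" where
  "pi_coeff M 0 = (\<lambda>xs. 0)"
| "pi_coeff M (Suc 0) = (\<lambda>xs. dupont_pi M (hd xs))"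
| "pi_coeff M (Suc (Suc n)) = precomp_H M (precomp_Q (pi_coeff M (Suc n)))"

definition pi_infinity ::
    "('k::field_char_0, 'f::comm_ring_1) interval_functions \<Rightarrow> ('f \<times> 'f) list \<Rightarrow> 'k whitney" where
  "pi_infinity M xs = pi_coeff M (length xs) xs"

subsection \<open>\<open>\<lambda>\<close> and \<open>log\<close>\<close>

definition lambda_mor ::
    "('k::field_char_0, 'f::comm_ring_1) interval_functions \<Rightarrow> ('f \<times> 'f) list \<Rightarrow> 'k whitney" where
  "lambda_mor M xs =
     (case xs of [] \<Rightarrow> 0 | [x] \<Rightarrow> dupont_pi M x | _ \<Rightarrow> (0, simplex_int M (map snd xs)))"

definition log_mor :: "'k::field_char_0 whitney list \<Rightarrow> 'k whitney" where
  "log_mor ws =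
     (case ws of [] \<Rightarrow> 0 | [w] \<Rightarrow> w
      | _ \<Rightarrow> (0, (- 1) ^ (length ws + 1) / of_nat (length ws) * prod_list (map snd ws)))"

definition phi :: "('k::field_char_0, 'f::comm_ring_1) interval_functions \<Rightarrow> ('f \<times> 'f) list \<Rightarrow> 'k whitney" where
  "phi M = A_inf_compose log_mor (lambda_mor M)"

end

theory Submission
  imports Defs
begin

text \<open>
  \<^bold>\<open>Reduction to one function on words.\<close> Let \<open>I [a\<^sub>1, \<dots>, a\<^sub>n]\<close> be the iterated integral of
  \<open>a\<^sub>1 dt, \<dots>, a\<^sub>n dt\<close> over the ordered simplex. Functions on words form an algebra under the
  convolution \<open>conv\<close> dual to deconcatenation, and the sum over blocks in \<open>\<phi> = log \<circ> \<lambda>\<close> is the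
  power series of the logarithm in this algebra. So in arity at least 2, \<open>\<phi>\<close> is
  \<open>(0, L (map snd xs))\<close> with \<open>L = log I\<close> (\<open>phi_eqI\<close>), and everything is a statement about \<open>L\<close>.

  \<^bold>\<open>Powers with an indeterminate exponent.\<close> On each word, the natural powers \<open>I\<^sup>m\<close> are the values
  at \<open>m\<close> of a polynomial \<open>pow_poly I\<close>, whose linear coefficient is \<open>L\<close> and whose \<open>p\<close>-th coefficient
  is \<open>L\<^sup>p / p!\<close> (\<open>coeff_pow_poly\<close>). In characteristic zero, a polynomial is determined by its
  values at the natural numbers. Thus a property of \<open>L\<close> follows by taking the linear coefficient in a
  property of the powers \<open>I\<^sup>m\<close>, which is proved by induction on \<open>m\<close>. This is used twice.

  \<^bold>\<open>Shuffles.\<close> By the product rule, \<open>I\<close> is a character of the shuffle algebra (\<open>character_I\<close>), hence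
  so is every \<open>I\<^sup>m\<close>. For nonempty words the product of the two polynomials has no linear
  term, so \<open>L\<close> vanishes on shuffle products (\<open>conv_log_shuffle\<close>).

  \<^bold>\<open>The morphism equation.\<close> On a word \<open>u f v\<close> with one function \<open>f\<close> between one-forms, the
  codifferential of the forms acts on functions of words by the derivation \<open>boundary\<close>.
  Integration by parts gives \<open>boundary I = f(0) \<mu> I - f(1) I \<mu>\<close>, where \<open>\<mu>\<close> marks the position of \<open>f\<close>
  (\<open>stokes\<close>). By the Leibniz rule, \<open>boundary (I\<^sup>m)\<close> is a sum of \<open>I\<^sup>j(u) I\<^bsup>m-j\<^esup>(v)\<close> over \<open>j\<close>, and since
  the power sums \<open>\<Sum>j<m. j\<^sup>r\<close> have the Bernoulli number \<open>B\<^sub>r\<close> as linear coefficient, the linear term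
  in \<open>m\<close> is the expression in \<open>L\<^sup>p(u) L\<^sup>q(v) B\<^bsub>p+q\<^esub>\<close> that the structure on Whitney forms
  prescribes (\<open>boundary_conv_log\<close>, \<open>sum_C_inf_taylor\<close>).

  \<^bold>\<open>Comparison with the transferred morphism.\<close> The formula for \<open>boundary L\<close> involves \<open>f\<close> only through
  \<open>f(0)\<close> and \<open>f(1)\<close>, which vanish if \<open>f\<close> is in the image of Dupont's homotopy \<open>h\<close>. So for such \<open>f\<close> the
  two products with the neighbours in \<open>L\<close> add up to \<open>L (u f' v)\<close>. As \<open>d(-h(a dt))\<close> is \<open>a dt\<close> minus
  its projection, the sum that defines \<open>\<pi>\<^sub>n\<close> telescopes from \<open>L\<close> of the given word to \<open>L\<close> of a
  word of constant forms, and the latter is zero because \<open>L\<close> vanishes on shuffle products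
  (\<open>precomp_H_phi\<close>). Hence \<open>\<phi>\<close> satisfies the recursion of \<open>\<pi>\<^sub>\<infinity>\<close>.

  Both kinds of forms enter through a few rules of calculus, collected in the locale
  \<open>interval_calculus\<close>.
\<close>

section \<open>Convolution of functions on words\<close>

definition conv :: "('a list \<Rightarrow> 'k::comm_ring_1) \<Rightarrow> ('a list \<Rightarrow> 'k) \<Rightarrow> 'a list \<Rightarrow> 'k" where
  "conv f g w = (\<Sum>i\<le>length w. f (take i w) * g (drop i w))"

definition conv_unit :: "'a list \<Rightarrow> 'k::comm_ring_1" where
  "conv_unit w = (if w = [] then 1 else 0)"

fun conv_pow :: "('a list \<Rightarrow> 'k::comm_ring_1) \<Rightarrow> nat \<Rightarrow> 'a list \<Rightarrow> 'k" where
  "conv_pow f 0 = conv_unit"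
| "conv_pow f (Suc n) = conv f (conv_pow f n)"

lemma conv_Nil [simp]: "conv f g [] = f [] * g []"
  by (simp add: conv_def)

lemma conv_Cons: "conv f g (x # w) = f [] * g (x # w) + conv (\<lambda>z. f (x # z)) g w"
  by (simp add: conv_def sum.atMost_Suc_shift del: sum.atMost_Suc)

text \<open>
  A marked letter \<open>x\<close> ends up either in the left or in the right factor. This is the source of all
  Leibniz rules below.
\<close>

lemma conv_append_Cons:
  "conv f g (u @ x # v) =
     conv (\<lambda>z. f (u @ x # z)) g v + conv f (\<lambda>z. g (z @ x # v)) u"
  by (induction u arbitrary: f) (simp_all add: conv_Cons algebra_simps)

lemma conv_add_left: "conv (\<lambda>z. f z + f' z) g w = conv f g w + conv f' g w"
  and conv_add_right: "conv f (\<lambda>z. g z + g' z) w = conv f g w + conv f g' w"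
  and conv_scale_left: "conv (\<lambda>z. c * f z) g w = c * conv f g w"
  and conv_scale_right: "conv f (\<lambda>z. c * g z) w = c * conv f g w"
  by (simp_all add: conv_def algebra_simps sum.distrib sum_distrib_left)

lemma conv_sum_right: "conv f (\<lambda>z. \<Sum>k\<in>A. g k z) w = (\<Sum>k\<in>A. conv f (g k) w)"
  unfolding conv_def sum_distrib_left by (rule sum.swap)

lemma conv_zero_left [simp]: "conv (\<lambda>z. 0) g w = 0"
  by (simp add: conv_def)

lemma conv_unit_left [simp]: "conv conv_unit g = g"
proof
  show "conv conv_unit g w = g w" for w
    by (cases w) (simp_all add: conv_Cons conv_unit_def)
qed

lemma conv_unit_right [simp]: "conv f conv_unit = f"
proof
  show "conv f conv_unit w = f w" for w
    by (induction w arbitrary: f) (simp_all add: conv_Cons conv_unit_def)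
qed

lemma conv_assoc: "conv (conv f g) h = conv f (conv g h)"
proof
  show "conv (conv f g) h w = conv f (conv g h) w" for w
    by (induction w arbitrary: f)
      (simp_all add: conv_Cons conv_add_left conv_scale_left algebra_simps)
qed

lemma conv_pow_add: "conv_pow f (m + n) = conv (conv_pow f m) (conv_pow f n)"
  by (induction m) (simp_all add: conv_assoc)

lemma conv_pow_vanish:
  assumes "f [] = 0" "length w < n"
  shows "conv_pow f n w = 0"
  using assms(2)
proof (induction n arbitrary: w)
  case (Suc n)
  show ?case
  proof (cases w)
    case (Cons x w')
    have "f (take i w) * conv_pow f n (drop i w) = 0" for i
    proof (cases "i = 0")
      case False
      then have "length (drop i w) < n"
        using Suc.prems Cons by auto
      then show ?thesis using Suc.IH by simp
    qed (use assms(1) in simp)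
    then show ?thesis
      by (simp add: conv_def)
  qed (simp add: assms(1))
qed simp

text \<open>
  The part of \<open>f\<close> in the augmentation ideal: if \<open>f [] = 1\<close> then \<open>f = conv_unit + reduced f\<close>, and
  \<open>conv_pow (reduced f) k\<close> vanishes on words shorter than \<open>k\<close>, so that power series in
  \<open>reduced f\<close> are finite sums on each word.
\<close>

definition reduced :: "('a list \<Rightarrow> 'k::comm_ring_1) \<Rightarrow> 'a list \<Rightarrow> 'k" where
  "reduced f w = (if w = [] then 0 else f w)"

lemma reduced_Nil [simp]: "reduced f [] = 0"
  by (simp add: reduced_def)

lemma conv_pow_binomial:
  assumes "f [] = (1 :: 'k::comm_ring_1)"
  shows "conv_pow f m w = (\<Sum>k\<le>m. of_nat (m choose k) * conv_pow (reduced f) k w)"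
proof (induction m arbitrary: w)
  case (Suc m)
  let ?J = "reduced f"
  have f: "f = (\<lambda>w. conv_unit w + ?J w)"
    by (auto simp: reduced_def conv_unit_def assms fun_eq_iff)
  have "conv_pow f (Suc m) w = conv_pow f m w + conv ?J (conv_pow f m) w"
  proof -
    have "conv_pow f (Suc m) w = conv (\<lambda>w. conv_unit w + ?J w) (conv_pow f m) w"
      using f by simp
    then show ?thesis by (simp add: conv_add_left)
  qed
  also have "conv_pow f m = (\<lambda>w. \<Sum>k\<le>m. of_nat (m choose k) * conv_pow ?J k w)"
    using Suc by blast
  also have "(\<Sum>k\<le>m. of_nat (m choose k) * conv_pow ?J k w) +
      conv ?J (\<lambda>w. \<Sum>k\<le>m. of_nat (m choose k) * conv_pow ?J k w) w =
      (\<Sum>k\<le>m. of_nat (m choose k) * conv_pow ?J k w) +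
      (\<Sum>k\<le>m. of_nat (m choose k) * conv_pow ?J (Suc k) w)"
    by (simp add: conv_sum_right conv_scale_right)
  also have "(\<Sum>k\<le>m. of_nat (m choose k) * conv_pow ?J k w) =
     (\<Sum>k\<le>Suc m. of_nat (m choose k) * conv_pow ?J k w)"
    by (simp add: binomial_eq_0)
  also have "\<dots> = conv_pow ?J 0 w + (\<Sum>k\<le>m. of_nat (m choose Suc k) * conv_pow ?J (Suc k) w)"
    by (subst sum.atMost_Suc_shift) simp
  also have "\<dots> + (\<Sum>k\<le>m. of_nat (m choose k) * conv_pow ?J (Suc k) w) =
     conv_pow ?J 0 w + (\<Sum>k\<le>m. of_nat (Suc m choose Suc k) * conv_pow ?J (Suc k) w)"
    by (simp add: algebra_simps sum.distrib)
  also have "\<dots> = (\<Sum>k\<le>Suc m. of_nat (Suc m choose k) * conv_pow ?J k w)"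
    by (subst sum.atMost_Suc_shift) simp
  finally show ?case .
qed simp


section \<open>Powers with an indeterminate exponent\<close>

definition binom_poly :: "nat \<Rightarrow> 'k::field_char_0 poly" where
  "binom_poly k = smult (1 / fact k) (\<Prod>i<k. [:- of_nat i, 1:])"

lemma poly_binom_poly: "poly (binom_poly k) (of_nat m) = of_nat (m choose k)"
  by (simp add: binom_poly_def poly_prod binomial_gbinomial gbinomial_prod_rev atLeast0LessThan
      algebra_simps)

text \<open>
  The derivative of \<open>s choose k\<close> at \<open>s = 0\<close> is the \<open>k\<close>-th coefficient of the series
  \<open>log (1 + x)\<close>: only the factor \<open>s\<close> of \<open>s (s - 1) \<dots> (s - k + 1)\<close> vanishes at \<open>0\<close>.
\<close>

lemma coeff_1_binom_poly: "coeff (binom_poly k :: 'k::field_char_0 poly) 1 = (- 1) ^ (k + 1) / of_nat k"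
proof (cases k)
  case 0
  then show ?thesis by (simp add: binom_poly_def)
next
  case (Suc n)
  have "(\<Prod>i<k. [:- of_nat i, 1:]) = [:0, 1:] * (\<Prod>i<n. [:- of_nat (Suc i), 1 :: 'k:])"
    unfolding Suc by (subst prod.lessThan_Suc_shift) simp
  also have "coeff \<dots> 1 = poly (\<Prod>i<n. [:- of_nat (Suc i), 1 :: 'k:]) 0"
    by (simp add: coeff_pCons poly_0_coeff_0)
  also have "\<dots> = (\<Prod>i<n. - of_nat (Suc i))"
    by (simp add: poly_prod)
  also have "\<dots> = (- 1) ^ n * fact n"
    by (induction n) (simp_all add: algebra_simps)
  finally show ?thesis
    unfolding binom_poly_def coeff_smult
    by (simp add: Suc divide_simps)
qed

lemma poly_eqI_nat:
  fixes p q :: "'k::field_char_0 poly"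
  assumes "\<And>m. poly p (of_nat m) = poly q (of_nat m)"
  shows "p = q"
proof (rule ccontr)
  assume "p \<noteq> q"
  then have "finite {x. poly (p - q) x = 0}"
    by (intro poly_roots_finite) simp
  moreover have "range of_nat \<subseteq> {x. poly (p - q) x = 0}"
    using assms by auto
  ultimately have "finite (range (of_nat :: nat \<Rightarrow> 'k))"
    by (rule finite_subset[rotated])
  then show False
    using finite_imageD[OF _ inj_of_nat] by simp
qed

text \<open>
  The binomial series \<open>(1 + x)\<^sup>s = \<Sum>k. (s choose k) x\<^sup>k\<close> at \<open>x = reduced f\<close>, with \<open>s\<close> the
  indeterminate of the polynomial ring.
\<close>

definition pow_poly :: "('a list \<Rightarrow> 'k::field_char_0) \<Rightarrow> 'a list \<Rightarrow> 'k poly" where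
  "pow_poly f w = (\<Sum>k\<le>length w. smult (conv_pow (reduced f) k w) (binom_poly k))"

text \<open>
  The summand \<open>k = 0\<close> is zero, as \<open>x / 0 = 0\<close>.
\<close>

definition conv_log :: "('a list \<Rightarrow> 'k::field_char_0) \<Rightarrow> 'a list \<Rightarrow> 'k" where
  "conv_log f w = (\<Sum>k\<le>length w. (- 1) ^ (k + 1) / of_nat k * conv_pow (reduced f) k w)"

lemma poly_pow_poly:
  assumes "f [] = 1"
  shows "poly (pow_poly f w) (of_nat m) = conv_pow f m w"
proof -
  let ?t = "\<lambda>k. of_nat (m choose k) * conv_pow (reduced f) k w"
  have "poly (pow_poly f w) (of_nat m) = (\<Sum>k\<le>length w. ?t k)"
    by (simp add: pow_poly_def poly_sum poly_binom_poly mult.commute)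
  also have "\<dots> = (\<Sum>k\<le>max m (length w). ?t k)"
    by (rule sum.mono_neutral_left) (auto simp: conv_pow_vanish)
  also have "\<dots> = (\<Sum>k\<le>m. ?t k)"
    by (rule sum.mono_neutral_right) auto
  finally show ?thesis
    using conv_pow_binomial[of f, OF assms] by simp
qed

lemma coeff_1_pow_poly: "coeff (pow_poly f w) 1 = conv_log f w"
  unfolding pow_poly_def conv_log_def coeff_sum coeff_smult coeff_1_binom_poly
  by (simp add: mult.commute)

lemma coeff_0_pow_poly:
  assumes "f [] = 1"
  shows "coeff (pow_poly f w) 0 = conv_unit w"
  using poly_pow_poly[of f w 0, OF assms] by (simp add: poly_0_coeff_0)

lemma conv_log_Nil [simp]: "conv_log f [] = 0"
  by (simp add: conv_log_def)

text \<open>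
  The differential equation \<open>(f\<^sup>s)' = (log f) f\<^sup>s\<close>, obtained by taking the linear coefficient
  in \<open>s\<close> of the group law \<open>f\<^bsup>s + j\<^esup> = f\<^sup>s f\<^sup>j\<close>.
\<close>

lemma pderiv_pow_poly:
  fixes f :: "'a list \<Rightarrow> 'k::field_char_0"
  assumes "f [] = 1"
  shows "pderiv (pow_poly f w) =
    (\<Sum>i\<le>length w. smult (conv_log f (take i w)) (pow_poly f (drop i w)))"
proof (rule poly_eqI_nat)
  fix j
  let ?q = "\<Sum>i\<le>length w. smult (poly (pow_poly f (drop i w)) (of_nat j)) (pow_poly f (take i w))"
  have "pcompose (pow_poly f w) [:of_nat j, 1:] = ?q"
  proof (rule poly_eqI_nat)
    fix m
    have "poly (pcompose (pow_poly f w) [:of_nat j, 1:]) (of_nat m) = conv_pow f (m + j) w"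
      using poly_pow_poly[of f w "m + j", OF assms] by (simp add: poly_pcompose add.commute)
    also have "\<dots> = poly ?q (of_nat m)"
      by (simp add: conv_pow_add conv_def poly_sum poly_pow_poly[of f, OF assms] mult.commute)
    finally show "poly (pcompose (pow_poly f w) [:of_nat j, 1:]) (of_nat m) = poly ?q (of_nat m)" .
  qed
  then have "coeff (pderiv (pcompose (pow_poly f w) [:of_nat j, 1:])) 0 = coeff (pderiv ?q) 0"
    by simp
  then show "poly (pderiv (pow_poly f w)) (of_nat j) =
     poly (\<Sum>i\<le>length w. smult (conv_log f (take i w)) (pow_poly f (drop i w))) (of_nat j)"
    by (simp add: pderiv_pcompose pderiv_pCons coeff_pderiv coeff_sum poly_sum mult.commute
        flip: coeff_1_pow_poly poly_0_coeff_0)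
       (simp add: poly_pcompose poly_0_coeff_0 poly_sum coeff_sum coeff_pderiv mult.commute)
qed

text \<open>
  The differential equation determines all coefficients: \<open>f\<^sup>s = exp (s log f)\<close>.
\<close>

lemma coeff_pow_poly:
  assumes "f [] = 1"
  shows "coeff (pow_poly f w) p = conv_pow (conv_log f) p w / fact p"
proof (induction p arbitrary: w)
  case 0
  then show ?case using coeff_0_pow_poly[of f, OF assms] by simp
next
  case (Suc p)
  have "of_nat (Suc p) * coeff (pow_poly f w) (Suc p) = coeff (pderiv (pow_poly f w)) p"
    by (simp add: coeff_pderiv)
  also have "\<dots> = conv_pow (conv_log f) (Suc p) w / fact p"
    by (simp add: pderiv_pow_poly[of f, OF assms] coeff_sum Suc conv_def sum_divide_distrib)
  finally show ?case
    by (simp add: divide_simps ac_simps del: of_nat_Suc conv_pow.simps)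
qed

lemma pow_poly_eq_sum:
  assumes "f [] = 1"
  shows "pow_poly f w =
    (\<Sum>p\<le>length w. monom (conv_pow (conv_log f) p w / fact p) p)"
proof (rule poly_eqI)
  fix n
  show "coeff (pow_poly f w) n =
    coeff (\<Sum>p\<le>length w. monom (conv_pow (conv_log f) p w / fact p) p) n"
    using conv_pow_vanish[of "conv_log f" w n]
    by (auto simp: coeff_pow_poly[of f, OF assms] coeff_sum)
qed


section \<open>Bernoulli numbers and power sums\<close>

definition power_sum_poly :: "nat \<Rightarrow> 'k::field_char_0 poly" where
  "power_sum_poly r =
     (\<Sum>k\<le>r. monom (fact r * bernoulli k / (fact k * fact (Suc r - k))) (Suc r - k))"

lemma fps_exp_minus_1_nonzero: "fps_exp (1 :: 'k::field_char_0) - 1 \<noteq> 0"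
proof
  assume "fps_exp (1 :: 'k) - 1 = 0"
  then have "fps_nth (fps_exp (1 :: 'k) - 1) 1 = 0" by simp
  then show False by simp
qed

lemma bernoulli_fps:
  "Abs_fps (\<lambda>n. bernoulli n / fact n) * (fps_exp (1 :: 'k::field_char_0) - 1) = fps_X"
proof -
  have "Abs_fps (\<lambda>n. bernoulli n / fact n) = fps_X / (fps_exp (1 :: 'k) - 1)"
    by (simp add: fps_eq_iff bernoulli_def)
  moreover have "(fps_exp (1 :: 'k) - 1) dvd fps_X"
  proof -
    have "subdegree (fps_exp (1 :: 'k) - 1) \<le> 1"
      by (rule subdegree_leI) simp
    then show ?thesis
      using fps_exp_minus_1_nonzero by (simp add: fps_dvd_iff)
  qed
  ultimately show ?thesis
    by simp
qed

text \<open>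
  Faulhaber's formula: compare the coefficients of \<open>z\<^bsup>r + 1\<^esup>\<close> in
  \<open>z (\<Sum>j<m. exp (j z)) = (z / (exp z - 1)) (exp (m z) - 1)\<close>.
\<close>

lemma poly_power_sum_poly:
  "poly (power_sum_poly r :: 'k::field_char_0 poly) (of_nat m) = (\<Sum>j<m. of_nat j ^ r)"
proof -
  let ?E = "fps_exp (1 :: 'k) - 1"
  let ?B = "Abs_fps (\<lambda>n. bernoulli n / fact n) :: 'k fps"
  let ?S = "\<Sum>j<m. fps_exp (of_nat j) :: 'k fps"
  have geom: "?S * ?E = fps_exp (of_nat m) - 1"
    by (induction m) (simp_all add: algebra_simps fps_exp_add_mult)
  have "?S * fps_X * ?E = (fps_exp (of_nat m) - 1) * ?B * ?E"
  proof -
    have "?S * fps_X * ?E = (?S * ?E) * fps_X"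
      by (simp only: ac_simps)
    also have "\<dots> = (fps_exp (of_nat m) - 1) * (?B * ?E)"
      unfolding geom bernoulli_fps ..
    finally show ?thesis
      by (simp only: mult.assoc)
  qed
  then have eq: "?S * fps_X = ?B * (fps_exp (of_nat m) - 1)"
    using fps_exp_minus_1_nonzero[where 'k = 'k] by (simp add: mult.commute[of ?B])
  have "fps_nth (?S * fps_X) (Suc r) = (\<Sum>j<m. of_nat j ^ r / fact r)"
    by (simp add: fps_sum_nth)
  moreover have "fps_nth (?B * (fps_exp (of_nat m) - 1)) (Suc r) =
      (\<Sum>k\<le>r. bernoulli k / fact k * (of_nat m ^ (Suc r - k) / fact (Suc r - k)))"
    by (simp add: fps_mult_nth atLeast0AtMost) (simp add: mult.commute)
  ultimately have "(\<Sum>j<m. of_nat j ^ r) / fact r =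
      (\<Sum>k\<le>r. bernoulli k / fact k * ((of_nat m :: 'k) ^ (Suc r - k) / fact (Suc r - k)))"
    using eq by (simp add: sum_divide_distrib)
  then have "(\<Sum>j<m. of_nat j ^ r) =
      fact r * (\<Sum>k\<le>r. bernoulli k / fact k * ((of_nat m :: 'k) ^ (Suc r - k) / fact (Suc r - k)))"
    by (simp add: field_simps)
  also have "\<dots> = poly (power_sum_poly r) (of_nat m)"
    unfolding power_sum_poly_def poly_sum poly_monom sum_distrib_left
    by (intro sum.cong) (simp_all add: field_simps)
  finally show ?thesis ..
qed

lemma coeff_0_power_sum_poly: "coeff (power_sum_poly r) 0 = 0"
  by (auto simp: power_sum_poly_def coeff_sum intro!: sum.neutral)

lemma coeff_1_power_sum_poly: "coeff (power_sum_poly r) 1 = bernoulli r"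
proof -
  have "coeff (power_sum_poly r) 1 =
      (\<Sum>k\<le>r. if k = r then bernoulli r else 0 :: 'a)"
    unfolding power_sum_poly_def coeff_sum
    by (intro sum.cong) auto
  then show ?thesis by simp
qed

lemma coeff_1_mult: "coeff (p * q) 1 = coeff p 0 * coeff q 1 + coeff p 1 * coeff (q :: 'k::comm_ring_1 poly) 0"
  by (simp add: coeff_mult)

text \<open>
  The polynomial in \<open>m\<close> that sums \<open>(m - j)\<^sup>p j\<^sup>q\<close> over \<open>j < m\<close>, by the binomial theorem.
\<close>

definition mixed_sum_poly :: "nat \<Rightarrow> nat \<Rightarrow> 'k::field_char_0 poly" where
  "mixed_sum_poly p q =
     (\<Sum>k\<le>p. monom (of_nat (p choose k) * (- 1) ^ k) (p - k) * power_sum_poly (k + q))"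

lemma poly_mixed_sum_poly:
  "poly (mixed_sum_poly p q :: 'k::field_char_0 poly) (of_nat m) =
     (\<Sum>j<m. (of_nat m - of_nat j) ^ p * of_nat j ^ q)"
proof -
  have "poly (mixed_sum_poly p q :: 'k poly) (of_nat m) = (\<Sum>k\<le>p. \<Sum>j<m.
      of_nat (p choose k) * (- of_nat j) ^ k * of_nat m ^ (p - k) * of_nat j ^ q)"
    unfolding mixed_sum_poly_def poly_sum poly_mult poly_monom poly_power_sum_poly sum_distrib_left
    by (intro sum.cong refl) (simp add: power_add power_minus[of "of_nat _"] algebra_simps)
  also have "\<dots> = (\<Sum>j<m. (\<Sum>k\<le>p.
      of_nat (p choose k) * (- of_nat j) ^ k * of_nat m ^ (p - k)) * of_nat j ^ q)"
    by (subst sum.swap) (simp add: sum_distrib_right)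
  also have "\<dots> = (\<Sum>j<m. (of_nat m - of_nat j) ^ p * of_nat j ^ q)"
    using binomial_ring[of "- of_nat _ :: 'k" "of_nat m" p] by simp
  finally show ?thesis .
qed

text \<open>
  The power sums have no constant term, so only the summand \<open>k = p\<close>, in which \<open>m\<close> does not occur as
  an explicit factor, contributes to the linear term.
\<close>

lemma coeff_1_mixed_sum_poly:
  "coeff (mixed_sum_poly p q) 1 = (- 1) ^ p * bernoulli (p + q)"
proof -
  have "coeff (mixed_sum_poly p q) 1 =
      (\<Sum>k\<le>p. if k = p then (- 1) ^ p * bernoulli (p + q) else 0 :: 'a)"
    unfolding mixed_sum_poly_def coeff_sum coeff_1_mult coeff_0_power_sum_poly coeff_1_power_sum_poly
    by (intro sum.cong) auto
  then show ?thesis by simp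
qed

section \<open>Shuffle products and characters\<close>

text \<open>
  The case of \<open>shuffle_sum\<close> in which the second word has even letters only, so that no signs occur.
\<close>

fun shuffle_add :: "('a list \<Rightarrow> 'k::comm_monoid_add) \<Rightarrow> 'a list \<Rightarrow> 'a list \<Rightarrow> 'k" where
  "shuffle_add F [] ys = F ys"
| "shuffle_add F (x # xs) [] = F (x # xs)"
| "shuffle_add F (x # xs) (y # ys) =
     shuffle_add (\<lambda>zs. F (x # zs)) xs (y # ys) + shuffle_add (\<lambda>zs. F (y # zs)) (x # xs) ys"

lemma shuffle_add_Nil_right [simp]: "shuffle_add F xs [] = F xs"
  by (cases xs) simp_all

lemma shuffle_add_hom:
  assumes "\<And>a b. h (a + b) = h a + h b"
  shows "h (shuffle_add F xs ys) = shuffle_add (\<lambda>zs. h (F zs)) xs ys"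
  by (induction F xs ys rule: shuffle_add.induct) (simp_all add: assms)

lemma shuffle_add_plus:
  "shuffle_add (\<lambda>zs. F zs + G zs) xs ys = shuffle_add F xs ys + shuffle_add G xs ys"
proof (induction F xs ys arbitrary: G rule: shuffle_add.induct)
  case (3 F x xs y ys)
  show ?case unfolding shuffle_add.simps 3 by (simp only: ac_simps)
qed simp_all

text \<open>
  The set of shuffles can equally be divided according to the last letter. Iterated integrals need
  this form, since their outermost integration variable is the last one.
\<close>

lemma shuffle_add_snoc:
  "shuffle_add F (xs @ [x]) (ys @ [y]) =
     shuffle_add (\<lambda>zs. F (zs @ [x])) xs (ys @ [y]) + shuffle_add (\<lambda>zs. F (zs @ [y])) (xs @ [x]) ys"
proof (induction F xs ys rule: shuffle_add.induct)
  case (1 F ys)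
  show ?case by (induction ys arbitrary: F) (simp_all add: ac_simps)
next
  case (2 F a xs)
  have "shuffle_add F (zs @ [x]) [y] = shuffle_add (\<lambda>zs. F (zs @ [x])) zs [y] + F (zs @ [x, y])" for zs
    by (induction zs arbitrary: F) (simp_all add: ac_simps)
  from this[of "a # xs"] show ?case by (simp add: ac_simps)
next
  case (3 F a xs b ys)
  then show ?case by (simp add: ac_simps)
qed

text \<open>
  The shuffle product is a morphism for deconcatenation; dually, evaluating a convolution on a
  shuffle product cuts both words independently.
\<close>

lemma shuffle_add_conv:
  fixes f g :: "'a list \<Rightarrow> 'k::comm_ring_1"
  shows "shuffle_add (conv f g) xs ys =
     (\<Sum>i\<le>length xs. \<Sum>j\<le>length ys.
        shuffle_add f (take i xs) (take j ys) * shuffle_add g (drop i xs) (drop j ys))"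
proof (induction f xs ys rule: shuffle_add.induct)
  case (1 f ys)
  then show ?case by (simp add: conv_def)
next
  case (2 f x xs)
  then show ?case by (simp add: conv_def)
next
  case (3 f x xs y ys)
  have scale: "shuffle_add (\<lambda>z. f [] * k z + h z) us vs =
      f [] * shuffle_add k us vs + shuffle_add h us vs" for us vs k h
    using shuffle_add_hom[of "\<lambda>a. f [] * a" k us vs]
    by (simp add: shuffle_add_plus algebra_simps)
  have "shuffle_add (conv f g) (x # xs) (y # ys) =
     f [] * shuffle_add g (x # xs) (y # ys) +
     shuffle_add (conv (\<lambda>z. f (x # z)) g) xs (y # ys) +
     shuffle_add (conv (\<lambda>z. f (y # z)) g) (x # xs) ys"
    by (simp add: conv_Cons scale algebra_simps)
  then show ?case
    unfolding 3
    by (simp add: sum.atMost_Suc_shift sum.distrib algebra_simps del: sum.atMost_Suc)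
qed

definition character :: "('a list \<Rightarrow> 'k::comm_ring_1) \<Rightarrow> bool" where
  "character f \<longleftrightarrow> f [] = 1 \<and> (\<forall>xs ys. shuffle_add f xs ys = f xs * f ys)"

lemma character_conv:
  assumes "character f" "character g"
  shows "character (conv f g)"
  using assms unfolding character_def shuffle_add_conv
  by (simp add: conv_def sum_product algebra_simps)

lemma character_conv_unit: "character (conv_unit :: 'a list \<Rightarrow> 'k::comm_ring_1)"
proof -
  have "shuffle_add (\<lambda>zs. 0) xs ys = (0 :: 'k)" for xs ys :: "'a list"
    using shuffle_add_hom[of "\<lambda>_. 0 :: 'k" "\<lambda>_. 0 :: 'k" xs ys] by simp
  then have "shuffle_add conv_unit xs ys = (conv_unit xs * conv_unit ys :: 'k)"
    for xs ys :: "'a list"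
    by (cases xs; cases ys) (simp_all add: conv_unit_def)
  then show ?thesis by (simp add: character_def) (simp add: conv_unit_def)
qed

lemma character_conv_pow: "character f \<Longrightarrow> character (conv_pow f m)"
  by (induction m) (simp_all add: character_conv character_conv_unit)

text \<open>
  All natural powers of a character are characters, so \<open>f\<^sup>s\<close> is one as a polynomial in \<open>s\<close>. On
  nonempty words it has no constant term, hence a product of two of its values has no linear term.
\<close>

lemma conv_log_shuffle:
  fixes f :: "'a list \<Rightarrow> 'k::field_char_0"
  assumes "character f" "xs \<noteq> []" "ys \<noteq> []"
  shows "shuffle_add (conv_log f) xs ys = 0"
proof -
  have f: "f [] = 1" using assms(1) by (simp add: character_def)
  have "shuffle_add (pow_poly f) xs ys = pow_poly f xs * pow_poly f ys"
  proof (rule poly_eqI_nat)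
    fix m
    have "poly (shuffle_add (pow_poly f) xs ys) (of_nat m) = shuffle_add (conv_pow f m) xs ys"
      by (subst shuffle_add_hom[where h = "\<lambda>p. poly p (of_nat m)"])
        (simp_all add: poly_pow_poly[of f, OF f])
    then show "poly (shuffle_add (pow_poly f) xs ys) (of_nat m) =
        poly (pow_poly f xs * pow_poly f ys) (of_nat m)"
      using character_conv_pow[OF assms(1), of m]
      by (simp add: character_def poly_pow_poly[of f, OF f])
  qed
  then have "coeff (shuffle_add (pow_poly f) xs ys) 1 = 0"
    using assms by (simp only: coeff_1_mult) (simp add: coeff_0_pow_poly[of f, OF f] conv_unit_def)
  then show ?thesis
    by (subst (asm) shuffle_add_hom[where h = "\<lambda>p. coeff p 1"])
      (simp_all only: coeff_add coeff_1_pow_poly)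
qed

text \<open>
  A letter can be inserted into the \<open>k\<close>-fold repetition of itself in \<open>k + 1\<close> ways.
\<close>

lemma shuffle_add_singleton_replicate:
  "shuffle_add F [x] (replicate k x) = of_nat (Suc k) * (F (replicate (Suc k) x) :: 'k::comm_ring_1)"
  by (induction k arbitrary: F) (simp_all add: algebra_simps)

lemma conv_log_replicate:
  fixes f :: "'a list \<Rightarrow> 'k::field_char_0"
  assumes "character f" "n \<ge> 2"
  shows "conv_log f (replicate n x) = 0"
proof -
  obtain k where n: "n = Suc (Suc k)" using assms(2) by (metis add_2_eq_Suc le_Suc_ex)
  have "shuffle_add (conv_log f) [x] (replicate (Suc k) x) = 0"
    by (rule conv_log_shuffle[OF assms(1)]) simp_all
  then show ?thesis
    unfolding shuffle_add_singleton_replicate n by (simp del: of_nat_Suc)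
qed


section \<open>The codifferential on words with one function\<close>

text \<open>
  The word \<open>u f v\<close> consists of a function \<open>f\<close> between one-forms, written by their coefficients. On it
  the codifferential of the forms gives the words with \<open>- d f\<close> in place of \<open>f\<close>, and those with
  \<open>f\<close> multiplied into the preceding or the following one-form; \<open>boundary d G\<close> evaluates \<open>G\<close> on their sum.
  The sign of the second term comes from \<open>Omega_Q2\<close>.
\<close>

definition boundary ::
    "('f \<Rightarrow> 'f) \<Rightarrow> ('f::comm_ring_1 list \<Rightarrow> 'k::comm_ring_1) \<Rightarrow> 'f list \<Rightarrow> 'f \<Rightarrow> 'f list \<Rightarrow> 'k" where
  "boundary d G u f v =
     - G (u @ d f # v)
     - (if u = [] then 0 else G (butlast u @ (last u * f) # v))
     + (if v = [] then 0 else G (u @ (f * hd v) # tl v))"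

lemma conv_minus_left: "conv (\<lambda>z. - f z) g w = - conv f g w"
  and conv_minus_right: "conv f (\<lambda>z. - g z) w = - conv f g w"
  and conv_diff_left: "conv (\<lambda>z. f z - f' z) g w = conv f g w - conv f' g w"
  and conv_diff_right: "conv f (\<lambda>z. g z - g' z) w = conv f g w - conv f g' w"
  by (simp_all add: conv_def algebra_simps sum_negf sum_subtractf)

lemma conv_mult_right: "conv f (\<lambda>z. g z * c) w = conv f g w * c"
  by (simp add: conv_def algebra_simps sum_distrib_left)

text \<open>
  A word that arises from \<open>u f v\<close> by one of the three operations is cut either to the right or to the
  left of the letter that has absorbed \<open>f\<close>. Therefore \<open>boundary d\<close> is a derivation, from functions on
  words to the bimodule of functions on words with one marked position.
\<close>

lemma boundary_conv:
  "boundary d (conv G H) u f v =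
     conv (\<lambda>z. boundary d G u f z) H v + conv G (\<lambda>z. boundary d H z f v) u"
  by (cases u rule: rev_cases; cases v)
    (simp_all add: boundary_def conv_append_Cons conv_Cons
      conv_add_left conv_add_right conv_minus_left conv_minus_right conv_diff_left conv_diff_right)

text \<open>
  If \<open>\<mu>\<close> denotes the unit at the marked position, the assumption reads
  \<open>boundary F = f0 \<mu> F - f1 F \<mu>\<close>; the Leibniz rule then gives
  \<open>boundary (F\<^sup>m) = (\<Sum>j<m. f0 F\<^sup>j \<mu> F\<^bsup>m - j\<^esup> - f1 F\<^bsup>j + 1\<^esup> \<mu> F\<^bsup>m - 1 - j\<^esup>)\<close>.
\<close>

lemma boundary_conv_pow:
  assumes stokes: "\<And>u v. boundary d F u f v = f0 * conv_unit u * F v - f1 * F u * conv_unit v"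
  shows "boundary d (conv_pow F m) u f v =
     f0 * (\<Sum>j<m. conv_pow F j u * conv_pow F (m - j) v) -
     f1 * (\<Sum>j<m. conv_pow F (Suc j) u * conv_pow F (m - Suc j) v)"
proof (induction m arbitrary: u v)
  case 0
  show ?case by (simp add: boundary_def conv_unit_def)
next
  case (Suc m)
  have "boundary d (conv_pow F (Suc m)) u f v =
      f0 * conv_unit u * conv F (conv_pow F m) v - f1 * F u * conv_pow F m v +
      (f0 * (\<Sum>j<m. conv_pow F (Suc j) u * conv_pow F (m - j) v) -
       f1 * (\<Sum>j<m. conv_pow F (Suc (Suc j)) u * conv_pow F (m - Suc j) v))"
    by (simp add: boundary_conv stokes Suc conv_diff_left conv_diff_right conv_scale_left
        conv_scale_right conv_sum_right conv_mult_right)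
  then show ?case
    by (simp only: sum.lessThan_Suc_shift) (simp add: algebra_simps)
qed

text \<open>
  In the sum for \<open>boundary (F\<^sup>m)\<close>, insert \<open>F\<^sup>s = exp (s L)\<close> and take the linear coefficient in \<open>m\<close>.
  The two inner sums differ by their first and last summands only. What they have in common is the
  sum of \<open>F\<^bsup>m - j\<^esup>(u) F\<^sup>j(v)\<close> over \<open>j < m\<close>, and thus the sum of
  \<open>(m - j)\<^sup>p j\<^sup>q L\<^sup>p(u) L\<^sup>q(v) / (p! q!)\<close>, which brings in the Bernoulli numbers.
\<close>

lemma boundary_conv_log:
  fixes F :: "'f::comm_ring_1 list \<Rightarrow> 'k::field_char_0"
  assumes stokes: "\<And>u v. boundary d F u f v = f0 * conv_unit u * F v - f1 * F u * conv_unit v"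
    and F: "F [] = 1"
  defines "L \<equiv> conv_log F"
  shows "boundary d L u f v =
     f0 * (conv_unit u * L v - L u * conv_unit v) -
     (f1 - f0) * (\<Sum>p\<le>length u. \<Sum>q\<le>length v.
        (- 1) ^ p * bernoulli (p + q) / (fact p * fact q) * conv_pow L p u * conv_pow L q v)"
proof -
  let ?P = "pow_poly F"
  let ?c = "\<lambda>w p. conv_pow L p w / fact p"
  let ?S = "\<Sum>p\<le>length u. \<Sum>q\<le>length v. smult (?c u p * ?c v q) (mixed_sum_poly p q)"
  let ?R = "smult f0 (?S + smult (conv_unit u) (?P v) - smult (conv_unit v) (?P u)) - smult f1 ?S"
  have P: "poly (?P w) x = (\<Sum>p\<le>length w. ?c w p * x ^ p)" for w x
    by (simp add: pow_poly_eq_sum[of F, OF F] poly_sum poly_monom L_def)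
  have S: "poly ?S (of_nat m) = (\<Sum>j<m. conv_pow F (m - j) u * conv_pow F j v)" for m
  proof -
    have "poly ?S (of_nat m) = (\<Sum>p\<le>length u. \<Sum>q\<le>length v. \<Sum>j<m.
        (?c u p * (of_nat m - of_nat j) ^ p) * (?c v q * of_nat j ^ q))"
      by (simp add: poly_sum poly_mixed_sum_poly sum_distrib_left mult_ac)
    also have "\<dots> = (\<Sum>j<m. poly (?P u) (of_nat m - of_nat j) * poly (?P v) (of_nat j))"
      unfolding P sum_product
      by (simp only: sum.swap[where B = "{..<m}"])
    also have "\<dots> = (\<Sum>j<m. conv_pow F (m - j) u * conv_pow F j v)"
      by (intro sum.cong refl)
        (simp add: poly_pow_poly[of F, OF F] flip: of_nat_diff)
    finally show ?thesis .
  qed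
  have "boundary d ?P u f v = ?R"
  proof (rule poly_eqI_nat)
    fix m
    \<comment> \<open>Reversing the order of summation makes \<open>?S\<close> appear, with the sign \<open>(- 1) ^ p\<close> instead of
      \<open>(- 1) ^ q\<close> in the end.\<close>
    let ?g = "\<lambda>j. conv_pow F (m - j) u * conv_pow F j v"
    have 1: "(\<Sum>j<m. conv_pow F j u * conv_pow F (m - j) v) = (\<Sum>j<m. ?g (Suc j))"
      by (subst sum.nat_diff_reindex[symmetric]) (auto intro!: sum.cong simp: Suc_diff_Suc)
    have 2: "(\<Sum>j<m. conv_pow F (Suc j) u * conv_pow F (m - Suc j) v) = (\<Sum>j<m. ?g j)"
      by (subst sum.nat_diff_reindex[symmetric])
        (intro sum.cong refl, simp add: Suc_diff_Suc del: conv_pow.simps)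
    have "poly (boundary d ?P u f v) (of_nat m) = boundary d (\<lambda>w. poly (?P w) (of_nat m)) u f v"
      by (simp add: boundary_def)
    also have "\<dots> = boundary d (conv_pow F m) u f v"
      by (simp add: poly_pow_poly[of F, OF F])
    also have "\<dots> = f0 * (\<Sum>j<m. ?g (Suc j)) - f1 * (\<Sum>j<m. ?g j)"
      by (simp only: boundary_conv_pow[of d F f f0 f1, OF stokes] 1 2)
    also have "(\<Sum>j<m. ?g (Suc j)) = (\<Sum>j<m. ?g j) + ?g m - ?g 0"
      using sum.lessThan_Suc_shift[of ?g m] sum.lessThan_Suc[of ?g m] by (simp add: algebra_simps)
    finally show "poly (boundary d ?P u f v) (of_nat m) = poly ?R (of_nat m)"
      using S[of m] by (simp add: poly_pow_poly[of F, OF F] mult_ac)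
  qed
  then have "coeff (boundary d ?P u f v) 1 = coeff ?R 1"
    by simp
  moreover have "coeff (boundary d ?P u f v) 1 = boundary d L u f v"
    by (simp add: boundary_def L_def coeff_1_pow_poly[unfolded One_nat_def])
  moreover have "coeff ?S 1 = (\<Sum>p\<le>length u. \<Sum>q\<le>length v.
        (- 1) ^ p * bernoulli (p + q) / (fact p * fact q) * conv_pow L p u * conv_pow L q v)"
    unfolding coeff_sum coeff_smult coeff_1_mixed_sum_poly by (simp add: mult_ac)
  ultimately show ?thesis
    by (simp only: coeff_diff coeff_add coeff_smult coeff_1_pow_poly L_def)
      (simp add: algebra_simps)
qed


section \<open>Sums over decompositions into blocks\<close>

lemma blocks_length: "yss \<in> blocks w \<Longrightarrow> length yss \<le> length w"
proof (induction yss arbitrary: w)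
  case (Cons ys yss)
  then have "yss \<in> blocks (concat yss)" "w = ys @ concat yss" "ys \<noteq> []"
    by (auto simp: blocks_def)
  with Cons.IH[of "concat yss"] show ?case
    by (cases ys) auto
qed simp

definition blocks_of_length :: "nat \<Rightarrow> 'a list \<Rightarrow> 'a list list set" where
  "blocks_of_length k w = {yss \<in> blocks w. length yss = k}"

text \<open>
  Splitting off the first block, of length \<open>i\<close>, is the recursion of \<open>conv_pow\<close>.
\<close>

lemma blocks_of_length_Suc:
  "blocks_of_length (Suc k) w =
     (\<lambda>(i, yss). take i w # yss) ` (SIGMA i:{1..length w}. blocks_of_length k (drop i w))"
proof (intro equalityI subsetI)
  fix zss assume "zss \<in> blocks_of_length (Suc k) w"
  then obtain ys yss where "zss = ys # yss" "length yss = k" "ys \<noteq> []" "[] \<notin> set yss"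
    "w = ys @ concat yss"
    by (cases zss) (auto simp: blocks_of_length_def blocks_def)
  then show "zss \<in> (\<lambda>(i, yss). take i w # yss) `
      (SIGMA i:{1..length w}. blocks_of_length k (drop i w))"
    by (intro image_eqI[of _ _ "(length ys, yss)"])
      (auto simp: blocks_of_length_def blocks_def Suc_le_eq)
qed (auto simp: blocks_of_length_def blocks_def)

lemma finite_blocks_of_length: "finite (blocks_of_length k w)"
proof (induction k arbitrary: w)
  case 0
  have "blocks_of_length 0 w \<subseteq> {[]}" by (auto simp: blocks_of_length_def)
  then show ?case by (rule finite_subset) simp
next
  case (Suc k)
  then show ?case unfolding blocks_of_length_Suc by (intro finite_imageI finite_SigmaI) auto
qed

lemma blocks_eq_UN: "blocks w = (\<Union>k\<le>length w. blocks_of_length k w)"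
  using blocks_length by (fastforce simp: blocks_of_length_def)

lemma finite_blocks: "finite (blocks w)"
  unfolding blocks_eq_UN by (simp add: finite_blocks_of_length)

lemma sum_blocks_of_length:
  "(\<Sum>yss\<in>blocks_of_length k w. prod_list (map F yss)) = conv_pow (reduced F) k w"
proof (induction k arbitrary: w)
  case 0
  have "blocks_of_length 0 w = (if w = [] then {[]} else {})"
    by (auto simp: blocks_of_length_def blocks_def)
  then show ?case by (simp add: conv_unit_def)
next
  case (Suc k)
  have "inj_on (\<lambda>(i, yss). take i w # yss) (SIGMA i:{1..length w}. blocks_of_length k (drop i w))"
  proof (rule inj_onI, clarsimp)
    fix i j assume "take i w = take j w" "i \<le> length w" "j \<le> length w"
    then show "i = j" by (metis length_take min.absorb2)
  qed
  then have "(\<Sum>yss\<in>blocks_of_length (Suc k) w. prod_list (map F yss)) =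
      (\<Sum>(i, yss)\<in>(SIGMA i:{1..length w}. blocks_of_length k (drop i w)).
          F (take i w) * prod_list (map F yss))"
    unfolding blocks_of_length_Suc by (subst sum.reindex) (auto simp: case_prod_beta)
  also have "\<dots> = (\<Sum>i\<in>{1..length w}. \<Sum>yss\<in>blocks_of_length k (drop i w).
          F (take i w) * prod_list (map F yss))"
    by (rule sum.Sigma[symmetric]) (auto simp: finite_blocks_of_length)
  also have "\<dots> = (\<Sum>i\<in>{1..length w}. reduced F (take i w) * conv_pow (reduced F) k (drop i w))"
    by (intro sum.cong refl) (auto simp: Suc reduced_def[of F "take _ w"] simp flip: sum_distrib_left)
  also have "\<dots> = conv_pow (reduced F) (Suc k) w"
    unfolding conv_pow.simps conv_def
    by (rule sum.mono_neutral_left) (auto simp: not_le)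
  finally show ?case .
qed

lemma sum_blocks:
  "(\<Sum>yss\<in>blocks w. h (length yss) * prod_list (map F yss)) =
     (\<Sum>k\<le>length w. h k * conv_pow (reduced F) k w)"
proof -
  have "(\<Sum>yss\<in>blocks w. h (length yss) * prod_list (map F yss)) =
      (\<Sum>k\<le>length w. \<Sum>yss\<in>blocks_of_length k w. h (length yss) * prod_list (map F yss))"
    unfolding blocks_eq_UN
    by (rule sum.UNION_disjoint)
      (auto simp: finite_blocks_of_length, auto simp: blocks_of_length_def)
  also have "\<dots> = (\<Sum>k\<le>length w. h k * conv_pow (reduced F) k w)"
  proof (rule sum.cong[OF refl])
    fix k
    have "(\<Sum>yss\<in>blocks_of_length k w. h (length yss) * prod_list (map F yss)) =
        (\<Sum>yss\<in>blocks_of_length k w. h k * prod_list (map F yss))"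
      by (rule sum.cong) (auto simp: blocks_of_length_def)
    then show "(\<Sum>yss\<in>blocks_of_length k w. h (length yss) * prod_list (map F yss)) =
        h k * conv_pow (reduced F) k w"
      by (simp add: sum_blocks_of_length flip: sum_distrib_left)
  qed
  finally show ?thesis .
qed

text \<open>
  A decomposition into blocks with a marked block of length 1 is the same as a marked letter together
  with decompositions of the words before and after it. In the morphism equation, only blocks
  of length 1 can have a function as value.
\<close>

lemma sum_blocks_marked:
  "(\<Sum>yss\<in>blocks xs. \<Sum>i<length yss.
      if length (yss ! i) = 1 then \<Phi> (take i yss) (hd (yss ! i)) (drop (Suc i) yss) else 0) =
   (\<Sum>i<length xs. \<Sum>bs\<in>blocks (take i xs). \<Sum>cs\<in>blocks (drop (Suc i) xs). \<Phi> bs (xs ! i) cs)"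
proof -
  let ?S = "SIGMA yss:blocks xs. {i. i < length yss \<and> length (yss ! i) = 1}"
  let ?T = "SIGMA i:{..<length xs}. SIGMA bs:blocks (take i xs). blocks (drop (Suc i) xs)"
  have "(\<Sum>yss\<in>blocks xs. \<Sum>i<length yss.
      if length (yss ! i) = 1 then \<Phi> (take i yss) (hd (yss ! i)) (drop (Suc i) yss) else 0) =
    (\<Sum>yss\<in>blocks xs. \<Sum>i\<in>{i. i < length yss \<and> length (yss ! i) = 1}.
       \<Phi> (take i yss) (hd (yss ! i)) (drop (Suc i) yss))"
    by (intro sum.cong[OF refl] sum.mono_neutral_cong_right) auto
  also have "\<dots> = (\<Sum>(yss, i)\<in>?S. \<Phi> (take i yss) (hd (yss ! i)) (drop (Suc i) yss))"
    by (rule sum.Sigma) (auto simp: finite_blocks)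
  also have "\<dots> = (\<Sum>(i, bs, cs)\<in>?T. \<Phi> bs (xs ! i) cs)"
  proof (rule sum.reindex_bij_witness[where
        j = "\<lambda>(yss, i). (length (concat (take i yss)), take i yss, drop (Suc i) yss)" and
        i = "\<lambda>(i, bs, cs). (bs @ [xs ! i] # cs, length bs)"])
    fix a assume "a \<in> ?S"
    then obtain yss i where a: "a = (yss, i)" "yss \<in> blocks xs" "i < length yss" "length (yss ! i) = 1"
      by auto
    then obtain x where x: "yss ! i = [x]"
      by (auto simp: length_Suc_conv)
    have yss: "yss = take i yss @ [x] # drop (Suc i) yss"
      using a(3) x by (metis id_take_nth_drop)
    have xs: "xs = concat (take i yss) @ x # concat (drop (Suc i) yss)"
      using a(2) unfolding blocks_def by (subst (asm) yss) simp
    have ne: "[] \<notin> set (take i yss)" "[] \<notin> set (drop (Suc i) yss)"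
      using a(2) in_set_takeD in_set_dropD by (fastforce simp: blocks_def)+
    have nth: "xs ! length (concat (take i yss)) = x"
      by (subst xs) simp
    have tk: "take (length (concat (take i yss))) xs = concat (take i yss)"
      by (subst xs) simp
    have dr: "drop (Suc (length (concat (take i yss)))) xs = concat (drop (Suc i) yss)"
      by (subst xs) simp
    have lt: "length (concat (take i yss)) < length xs"
      using arg_cong[OF xs, of length] by (simp del: length_concat)
    show "(case case a of (yss, i) \<Rightarrow> (length (concat (take i yss)), take i yss, drop (Suc i) yss) of
        (i, bs, cs) \<Rightarrow> (bs @ [xs ! i] # cs, length bs)) = a"
      using a nth yss by auto
    show "(case a of (yss, i) \<Rightarrow> (length (concat (take i yss)), take i yss, drop (Suc i) yss)) \<in> ?T"
      using a(1) lt tk dr ne by (auto simp: blocks_def simp del: length_concat)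
    show "(case case a of (yss, i) \<Rightarrow> (length (concat (take i yss)), take i yss, drop (Suc i) yss) of
        (i, bs, cs) \<Rightarrow> \<Phi> bs (xs ! i) cs) =
        (case a of (yss, i) \<Rightarrow> \<Phi> (take i yss) (hd (yss ! i)) (drop (Suc i) yss))"
      using a(1) nth x by simp
  next
    fix b assume "b \<in> ?T"
    then obtain i bs cs where b: "b = (i, bs, cs)" "i < length xs" "concat bs = take i xs"
      "concat cs = drop (Suc i) xs" "[] \<notin> set bs" "[] \<notin> set cs"
      by (auto simp: blocks_def)
    have len: "length (concat bs) = i" using b(2,3) by simp
    show "(case case b of (i, bs, cs) \<Rightarrow> (bs @ [xs ! i] # cs, length bs) of
        (yss, i) \<Rightarrow> (length (concat (take i yss)), take i yss, drop (Suc i) yss)) = b"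
      using b(1) len by simp
    show "(case b of (i, bs, cs) \<Rightarrow> (bs @ [xs ! i] # cs, length bs)) \<in> ?S"
      using b by (auto simp: blocks_def id_take_nth_drop[symmetric])
  qed
  also have "\<dots> = (\<Sum>i<length xs. \<Sum>bs\<in>blocks (take i xs). \<Sum>cs\<in>blocks (drop (Suc i) xs).
      \<Phi> bs (xs ! i) cs)"
    by (simp add: sum.Sigma finite_blocks)
  finally show ?thesis .
qed

section \<open>Iterated integrals on the interval\<close>

lemma multilinear_iff:
  assumes "vector_space s" "vector_space s'"
  shows "multilinear s s' F \<longleftrightarrow>
    (\<forall>u v x y. F (u @ (x + y) # v) = F (u @ x # v) + F (u @ y # v)) \<and>
    (\<forall>u v c x. F (u @ s c x # v) = s' c (F (u @ x # v)))"
  unfolding multilinear_def Vector_Spaces.linear_iff using assms by auto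

lemma vector_space_mult: "vector_space ((*) :: 'k::field \<Rightarrow> 'k \<Rightarrow> 'k)"
  by unfold_locales (simp_all add: algebra_simps)

text \<open>
  The rules of calculus that hold for smooth and for polynomial functions alike. The last one says
  that integrals over the simplex can be evaluated one variable at a time, \<open>t\<^sub>1\<close> first.
\<close>

locale interval_calculus =
  fixes M :: "('k::field_char_0, 'f::comm_ring_1) interval_functions"
  assumes vector_space_scale: "vector_space (scale_fn M)"
    and scale_mult: "scale_fn M c f * g = scale_fn M c (f * g)"
    and eval_add: "e = 0 \<or> e = 1 \<Longrightarrow> eval_fn M (f + g) e = eval_fn M f e + eval_fn M g e"
    and eval_mult: "e = 0 \<or> e = 1 \<Longrightarrow> eval_fn M (f * g) e = eval_fn M f e * eval_fn M g e"
    and eval_scale: "e = 0 \<or> e = 1 \<Longrightarrow> eval_fn M (scale_fn M c f) e = c * eval_fn M f e"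
    and eval_one: "e = 0 \<or> e = 1 \<Longrightarrow> eval_fn M 1 e = 1"
    and coord_0: "eval_fn M (coord M) 0 = 0"
    and coord_1: "eval_fn M (coord M) 1 = 1"
    and deriv_add: "deriv_fn M (f + g) = deriv_fn M f + deriv_fn M g"
    and deriv_scale: "deriv_fn M (scale_fn M c f) = scale_fn M c (deriv_fn M f)"
    and deriv_mult: "deriv_fn M (f * g) = deriv_fn M f * g + f * deriv_fn M g"
    and deriv_coord: "deriv_fn M (coord M) = 1"
    and primitive_add: "primitive M (f + g) = primitive M f + primitive M g"
    and primitive_scale: "primitive M (scale_fn M c f) = scale_fn M c (primitive M f)"
    and primitive_0: "eval_fn M (primitive M f) 0 = 0"
    and deriv_primitive: "deriv_fn M (primitive M f) = f"
    and primitive_deriv: "primitive M (deriv_fn M f) = f - scale_fn M (eval_fn M f 0) 1"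
    and simplex_int_eq:
      "simplex_int M as = eval_fn M (foldl (\<lambda>g a. primitive M (a * g)) 1 as) 1"
begin

sublocale scale: vector_space "scale_fn M"
  by (rule vector_space_scale)

text \<open>
  For \<open>g = 1\<close> this is the iterated integral as a function of its upper limit. A general \<open>g\<close> is
  admitted so that a word can be integrated in two stages.
\<close>

definition iter :: "'f \<Rightarrow> 'f list \<Rightarrow> 'f" where
  "iter = foldl (\<lambda>g a. primitive M (a * g))"

abbreviation I :: "'f list \<Rightarrow> 'k" where
  "I \<equiv> simplex_int M"

text \<open>
  The logarithm of Chen's series of iterated integrals.
\<close>

definition L :: "'f list \<Rightarrow> 'k" where
  "L = conv_log I"

lemma iter_simps [simp]:
  "iter g [] = g"
  "iter g (a # as) = iter (primitive M (a * g)) as"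
  "iter g (as @ bs) = iter (iter g as) bs"
  by (simp_all add: iter_def)

lemma I_eq: "I as = eval_fn M (iter 1 as) 1"
  by (simp add: simplex_int_eq iter_def)

lemma I_Nil [simp]: "I [] = 1"
  by (simp add: I_eq eval_one)

lemma mult_scale: "g * scale_fn M c f = scale_fn M c (g * f)"
  using scale_mult[of c f g] by (simp add: mult.commute)

lemma eval_zero: "e = 0 \<or> e = 1 \<Longrightarrow> eval_fn M 0 e = 0"
  using eval_add[of e 0 0] by simp

lemma eval_minus: "e = 0 \<or> e = 1 \<Longrightarrow> eval_fn M (- f) e = - eval_fn M f e"
  using eval_add[of e f "- f"] eval_zero[of e] by (simp add: eq_neg_iff_add_eq_0 add.commute)

lemma eval_diff: "e = 0 \<or> e = 1 \<Longrightarrow> eval_fn M (f - g) e = eval_fn M f e - eval_fn M g e"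
  using eval_add[of e f "- g"] eval_minus[of e g] by simp

lemma primitive_zero: "primitive M 0 = 0"
  using primitive_add[of 0 0] by simp

lemma primitive_minus: "primitive M (- f) = - primitive M f"
  using primitive_add[of f "- f"] primitive_zero by (simp add: eq_neg_iff_add_eq_0 add.commute)

lemma primitive_diff: "primitive M (f - g) = primitive M f - primitive M g"
  using primitive_add[of f "- g"] primitive_minus[of g] by simp

lemma deriv_zero: "deriv_fn M 0 = 0"
  using deriv_add[of 0 0] by simp

lemma deriv_one: "deriv_fn M 1 = 0"
  using deriv_mult[of 1 1] by simp

lemma deriv_minus: "deriv_fn M (- f) = - deriv_fn M f"
  using deriv_add[of f "- f"] deriv_zero by (simp add: eq_neg_iff_add_eq_0 add.commute)

lemma deriv_diff: "deriv_fn M (f - g) = deriv_fn M f - deriv_fn M g"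
  using deriv_add[of f "- g"] deriv_minus[of g] by simp

lemma iter_add: "iter (f + g) as = iter f as + iter g as"
  by (induction as arbitrary: f g) (simp_all add: primitive_add distrib_left)

lemma iter_scale: "iter (scale_fn M c f) as = scale_fn M c (iter f as)"
  by (induction as arbitrary: f) (simp_all add: primitive_scale mult_scale)

lemma iter_diff: "iter (f - g) as = iter f as - iter g as"
  by (induction as arbitrary: f g) (simp_all add: primitive_diff right_diff_distrib)

lemma primitive_by_parts:
  "primitive M (deriv_fn M f * g) =
     f * g - scale_fn M (eval_fn M f 0 * eval_fn M g 0) 1 - primitive M (f * deriv_fn M g)"
proof -
  have "primitive M (deriv_fn M f * g) + primitive M (f * deriv_fn M g) =
      primitive M (deriv_fn M (f * g))"
    by (simp add: deriv_mult primitive_add)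
  then show ?thesis
    by (simp add: primitive_deriv eval_mult algebra_simps)
qed

text \<open>
  Integrate the prefix \<open>u\<close> first, then \<open>f'\<close> by parts. The boundary terms multiply \<open>f\<close> into the next
  form, or evaluate it at 1 if there is none; the remaining integral multiplies \<open>f\<close> into
  the preceding form. The constant \<open>f(0)\<close> survives only if \<open>u\<close> is empty, as \<open>iter 1 u\<close> vanishes at 0
  otherwise.
\<close>

lemma stokes:
  "boundary (deriv_fn M) I u f v =
     eval_fn M f 0 * conv_unit u * I v - eval_fn M f 1 * I u * conv_unit v"
proof -
  let ?g = "iter 1 u"
  have "I (u @ deriv_fn M f # v) = eval_fn M (iter (f * ?g) v) 1 -
      eval_fn M f 0 * eval_fn M ?g 0 * I v - eval_fn M (iter (primitive M (f * deriv_fn M ?g)) v) 1"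
    by (simp add: I_eq primitive_by_parts iter_diff iter_scale eval_diff eval_scale)
  moreover have "eval_fn M (iter (f * ?g) v) 1 =
      (if v = [] then eval_fn M f 1 * I u else I (u @ (f * hd v) # tl v))"
    by (cases v) (simp_all add: I_eq eval_mult ac_simps)
  moreover have "eval_fn M ?g 0 = conv_unit u"
    by (cases u rule: rev_cases) (simp_all add: conv_unit_def eval_one primitive_0)
  moreover have "eval_fn M (iter (primitive M (f * deriv_fn M ?g)) v) 1 =
      (if u = [] then 0 else I (butlast u @ (last u * f) # v))"
  proof (cases u rule: rev_cases)
    case Nil
    have "iter 0 v = 0" using iter_diff[of 0 0 v] by simp
    then show ?thesis using Nil by (simp add: deriv_one primitive_zero eval_zero)
  next
    case (snoc u' a)
    then show ?thesis by (simp add: I_eq deriv_primitive ac_simps)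
  qed
  ultimately show ?thesis
    by (simp add: boundary_def conv_unit_def)
qed

text \<open>
  For nonempty words, both sides vanish at 0 and have the same derivative, by the product rule and
  induction.
\<close>

lemma iter_shuffle: "shuffle_add (iter 1) xs ys = iter 1 xs * iter 1 ys"
proof (induction "length xs + length ys" arbitrary: xs ys rule: less_induct)
  case less
  show ?case
  proof (cases "xs = [] \<or> ys = []")
    case True
    then show ?thesis by auto
  next
    case False
    then obtain xs' x ys' y where xs: "xs = xs' @ [x]" and ys: "ys = ys' @ [y]"
      by (metis rev_exhaust)
    have snoc: "shuffle_add (\<lambda>zs. iter 1 (zs @ [a])) us vs = primitive M (a * shuffle_add (iter 1) us vs)"
      for a us vs
      by (subst shuffle_add_hom[where h = "\<lambda>f. primitive M (a * f)"])
        (simp_all add: distrib_left primitive_add)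
    let ?F = "iter 1 xs" and ?G = "iter 1 ys"
    have "shuffle_add (iter 1) xs ys =
        primitive M (x * (iter 1 xs' * ?G)) + primitive M (y * (?F * iter 1 ys'))"
      unfolding xs ys shuffle_add_snoc snoc
      by (subst less, simp add: xs ys)+ (simp add: xs ys)
    also have "\<dots> = primitive M (deriv_fn M (?F * ?G))"
      by (simp add: xs ys deriv_mult deriv_primitive ac_simps flip: primitive_add)
    also have "\<dots> = ?F * ?G"
      by (simp add: primitive_deriv eval_mult xs primitive_0)
    finally show ?thesis .
  qed
qed

lemma character_I: "character I"
proof -
  have "shuffle_add I xs ys = I xs * I ys" for xs ys
  proof -
    have "shuffle_add I xs ys = shuffle_add (\<lambda>w. eval_fn M (iter 1 w) 1) xs ys"
      by (simp add: I_eq[abs_def])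
    also have "\<dots> = eval_fn M (shuffle_add (iter 1) xs ys) 1"
      by (subst shuffle_add_hom[where h = "\<lambda>f. eval_fn M f 1"]) (simp_all add: eval_add)
    finally show ?thesis by (simp add: iter_shuffle eval_mult I_eq)
  qed
  then show ?thesis by (simp add: character_def)
qed

lemma multilinear_I: "multilinear (scale_fn M) (*) I"
  unfolding multilinear_iff[OF vector_space_scale vector_space_mult]
  by (simp add: I_eq distrib_right primitive_add iter_add eval_add
      scale_mult primitive_scale iter_scale eval_scale)

end

lemma multilinear_conv:
  assumes "multilinear s (*) f" "multilinear s (*) g" "vector_space s"
  shows "multilinear s (*) (conv f g)"
  using assms(1,2) unfolding multilinear_iff[OF assms(3) vector_space_mult]
  by (auto simp: conv_append_Cons conv_add_left conv_add_right conv_scale_left conv_scale_right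
      algebra_simps)

lemma multilinear_conv_pow:
  assumes "multilinear s (*) f" "vector_space s"
  shows "multilinear s (*) (conv_pow f n)"
proof (induction n)
  case 0
  show ?case
    by (simp add: multilinear_iff[OF assms(2) vector_space_mult] conv_unit_def)
next
  case (Suc n)
  then show ?case using multilinear_conv assms by auto
qed

lemma multilinear_conv_log:
  assumes "multilinear s (*) f" "vector_space s"
  shows "multilinear s (*) (conv_log f)"
proof -
  have "multilinear s (*) (reduced f)"
    using assms(1) by (simp add: multilinear_iff[OF assms(2) vector_space_mult] reduced_def)
  then have "multilinear s (*) (conv_pow (reduced f) k)" for k
    using multilinear_conv_pow assms(2) by blast
  then have "multilinear s (*) (\<lambda>w. \<Sum>k\<le>length w. c k * conv_pow (reduced f) k w)" for c
    by (simp add: multilinear_iff[OF assms(2) vector_space_mult] distrib_left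
        sum.distrib sum_distrib_left mult.left_commute del: sum.atMost_Suc)
  then show ?thesis
    unfolding conv_log_def[abs_def] .
qed

context interval_calculus
begin

lemma multilinear_L: "multilinear (scale_fn M) (*) L"
  unfolding L_def by (rule multilinear_conv_log[OF multilinear_I vector_space_scale])

lemma L_add: "L (u @ (x + y) # v) = L (u @ x # v) + L (u @ y # v)"
  and L_scale: "L (u @ scale_fn M c x # v) = c * L (u @ x # v)"
  using multilinear_L unfolding multilinear_iff[OF vector_space_scale vector_space_mult] by blast+

lemma L_zero: "L (u @ 0 # v) = 0"
  using L_add[of u 0 0 v] by simp

lemma L_zero_mem: "0 \<in> set w \<Longrightarrow> L w = 0"
  by (metis split_list L_zero)

lemma L_minus: "L (u @ - x # v) = - L (u @ x # v)"
  using L_add[of u x "- x" v] L_zero[of u v] by (simp add: eq_neg_iff_add_eq_0 add.commute)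

lemma L_diff: "L (u @ (x - y) # v) = L (u @ x # v) - L (u @ y # v)"
  using L_add[of u x "- y" v] by (simp add: L_minus)

lemma L_Nil [simp]: "L [] = 0"
  by (simp add: L_def)

lemma L_single [simp]: "L [a] = I [a]"
  by (simp add: L_def conv_log_def conv_def conv_unit_def reduced_def)

lemma boundary_L:
  "boundary (deriv_fn M) L u f v =
     eval_fn M f 0 * (conv_unit u * L v - L u * conv_unit v) -
     (eval_fn M f 1 - eval_fn M f 0) * (\<Sum>p\<le>length u. \<Sum>q\<le>length v.
        (- 1) ^ p * bernoulli (p + q) / (fact p * fact q) * conv_pow L p u * conv_pow L q v)"
  unfolding L_def by (rule boundary_conv_log[OF stokes I_Nil])

text \<open>
  By multilinearity this is about a repeated letter, where \<open>conv_log_replicate\<close> applies.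
\<close>

lemma L_constants:
  assumes "length cs \<ge> 2"
  shows "L (map (\<lambda>c. scale_fn M c 1) cs) = 0"
proof -
  have "L (u @ map (\<lambda>c. scale_fn M c 1) cs) = prod_list cs * L (u @ replicate (length cs) 1)" for u
  proof (induction cs arbitrary: u)
    case (Cons c cs)
    show ?case
      using Cons[of "u @ [1]"] by (simp add: L_scale)
  qed simp
  from this[of "[]"] show ?thesis
    using conv_log_replicate[OF character_I assms, of 1] by (simp add: L_def)
qed


section \<open>The Taylor coefficients of \<open>\<phi>\<close>\<close>

lemma dupont_pi_eq:
  "dupont_pi M x = ((eval_fn M (fst x) 1, eval_fn M (fst x) 0), I [snd x])"
  by (simp add: dupont_pi_def integral01_def I_eq split: prod.split)

lemma dupont_pi_zero: "dupont_pi M 0 = 0"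
  by (simp add: dupont_pi_eq eval_zero I_eq primitive_zero zero_prod_def)

lemma conv_map: "conv (\<lambda>w. f (map h w)) (\<lambda>w. g (map h w)) w = conv f g (map h w)"
  by (simp add: conv_def take_map drop_map)

lemma conv_pow_map: "conv_pow (\<lambda>w. f (map h w)) k w = conv_pow f k (map h w)"
proof (induction k arbitrary: w)
  case (Suc k)
  then have "conv_pow (\<lambda>w. f (map h w)) k = (\<lambda>w. conv_pow f k (map h w))"
    by blast
  then show ?case
    using conv_map[of f h "conv_pow f k" w] by (simp only: conv_pow.simps)
qed (simp add: conv_unit_def)

lemma snd_log_mor:
  "ws \<noteq> [] \<Longrightarrow> snd (log_mor ws) = (- 1) ^ (length ws + 1) / of_nat (length ws) * prod_list (map snd ws)"
  by (auto simp: log_mor_def split: list.split)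

lemma snd_lambda_mor: "ys \<noteq> [] \<Longrightarrow> snd (lambda_mor M ys) = I (map snd ys)"
  by (auto simp: lambda_mor_def dupont_pi_eq split: list.split)

text \<open>
  The coefficients of \<open>log\<close> are those of the logarithm series, and \<open>\<lambda>\<close> is \<open>I\<close> on one-forms, so the
  composition formula is the definition of \<open>conv_log I\<close>.
\<close>

lemma snd_phi:
  assumes "xs \<noteq> []"
  shows "snd (phi M xs) = L (map snd xs)"
proof -
  have "snd (phi M xs) = (\<Sum>yss\<in>blocks xs.
      (- 1) ^ (length yss + 1) / of_nat (length yss) * prod_list (map (\<lambda>ys. I (map snd ys)) yss))"
    unfolding phi_def A_inf_compose_def snd_sum
  proof (rule sum.cong[OF refl])
    fix yss assume "yss \<in> blocks xs"
    then have "yss \<noteq> []" and ne: "\<And>ys. ys \<in> set yss \<Longrightarrow> ys \<noteq> []"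
      using assms by (auto simp: blocks_def)
    moreover have "map (snd \<circ> lambda_mor M) yss = map (\<lambda>ys. I (map snd ys)) yss"
      using ne by (auto simp: snd_lambda_mor)
    ultimately show "snd (log_mor (map (lambda_mor M) yss)) =
      (- 1) ^ (length yss + 1) / of_nat (length yss) * prod_list (map (\<lambda>ys. I (map snd ys)) yss)"
      by (simp add: snd_log_mor del: map_eq_conv)
  qed
  also have "\<dots> = (\<Sum>k\<le>length xs.
      (- 1) ^ (k + 1) / of_nat k * conv_pow (reduced (\<lambda>ys. I (map snd ys))) k xs)"
    by (rule sum_blocks)
  also have "reduced (\<lambda>ys. I (map snd ys)) = (\<lambda>ys. reduced I (map snd ys))"
    by (auto simp: reduced_def)
  finally show ?thesis
    by (simp add: L_def conv_log_def conv_pow_map)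
qed

text \<open>
  Only the summand of \<open>log\<^sub>1\<close> could be a function, and \<open>\<lambda>\<^sub>n\<close> takes values in one-forms for \<open>n \<ge> 2\<close>.
\<close>

lemma fst_phi:
  assumes "length xs \<ge> 2"
  shows "fst (phi M xs) = 0"
proof -
  have "fst (log_mor (map (lambda_mor M) yss)) = 0" if "yss \<in> blocks xs" for yss
  proof (cases "length yss = 1")
    case True
    then have "yss = [xs]"
      using that by (auto simp: blocks_def length_Suc_conv)
    then show ?thesis
      using assms by (auto simp: log_mor_def lambda_mor_def split: list.split)
  next
    case False
    then show ?thesis
      by (auto simp: log_mor_def zero_prod_def split: list.split)
  qed
  then show ?thesis
    unfolding phi_def A_inf_compose_def fst_sum by simp
qed

lemma phi_single: "phi M [x] = dupont_pi M x"
proof -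
  have "blocks [x] = {[[x]]}"
  proof (intro equalityI subsetI)
    fix yss assume "yss \<in> blocks [x]"
    moreover from this have "length yss \<le> 1" using blocks_length[of yss "[x]"] by simp
    ultimately show "yss \<in> {[[x]]}"
      by (cases yss) (auto simp: blocks_def)
  qed (auto simp: blocks_def)
  then show ?thesis
    by (simp add: phi_def A_inf_compose_def log_mor_def lambda_mor_def)
qed

lemma phi_eqI:
  assumes "length xs \<ge> 2"
  shows "phi M xs = (0, L (map snd xs))"
proof -
  have "xs \<noteq> []" using assms by auto
  then show ?thesis
    using fst_phi[OF assms] snd_phi[of xs] by (simp add: prod_eq_iff)
qed

lemma phi_zero: "phi M (us @ 0 # ws) = 0"
proof (cases "us @ ws = []")
  case True
  then show ?thesis by (simp add: phi_single dupont_pi_zero)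
next
  case False
  then have "length (us @ 0 # ws) \<ge> 2" by (cases us; cases ws) auto
  then show ?thesis by (simp add: phi_eqI L_zero zero_prod_def)
qed

end

section \<open>The \<open>C\<^sub>\<infinity>\<close> structure on Whitney forms\<close>

lemma bernoulli_0: "bernoulli 0 = (1 :: 'k::field_char_0)"
proof -
  have "fps_nth (Abs_fps (\<lambda>n. bernoulli n / fact n) * (fps_exp (1 :: 'k) - 1)) 1 = 1"
    unfolding bernoulli_fps by simp
  then show ?thesis by (simp add: fps_mult_nth)
qed

lemma bernoulli_1: "bernoulli 1 = (- 1 / 2 :: 'k::field_char_0)"
proof -
  have "fps_nth (Abs_fps (\<lambda>n. bernoulli n / fact n) * (fps_exp (1 :: 'k) - 1)) 2 = 0"
    unfolding bernoulli_fps by simp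
  then show ?thesis
    by (simp add: fps_mult_nth numeral_2_eq_2 bernoulli_0 eq_neg_iff_add_eq_0 add.commute)
qed

lemma prod_list_nth: "prod_list xs = (\<Prod>i<length xs. xs ! i :: 'k::comm_monoid_mult)"
  by (simp add: prod.list_conv_set_nth atLeast0LessThan)

lemma prod_list_take_drop:
  fixes f :: "'a \<Rightarrow> 'k::comm_monoid_mult"
  assumes "i < length ws"
  shows "prod_list (map f (take i ws)) * prod_list (map f (drop (Suc i) ws)) =
    (\<Prod>j\<in>{..length ws - 1} - {i}. f (ws ! j))"
proof -
  have "prod_list (map f (take i ws)) = (\<Prod>j\<in>{..<i}. f (ws ! j))"
    using assms by (simp add: prod_list_nth)
  moreover have "prod_list (map f (drop (Suc i) ws)) = (\<Prod>j\<in>{Suc i..<length ws}. f (ws ! j))"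
    using assms unfolding prod_list_nth
    by (intro prod.reindex_bij_witness[where i = "\<lambda>j. j - Suc i" and j = "\<lambda>j. j + Suc i"])
      (auto simp: add.commute)
  moreover have "{..length ws - 1} - {i} = {..<i} \<union> {Suc i..<length ws}"
    using assms by auto
  moreover have "(\<Prod>j\<in>{..<i} \<union> {Suc i..<length ws}. f (ws ! j)) =
      (\<Prod>j\<in>{..<i}. f (ws ! j)) * (\<Prod>j\<in>{Suc i..<length ws}. f (ws ! j))"
    by (rule prod.union_disjoint) auto
  ultimately show ?thesis by simp
qed

text \<open>
  The coefficient in the structure on Whitney forms of a function with values \<open>a\<close> at 1 and \<open>b\<close> at 0,
  preceded by \<open>p\<close> and followed by \<open>q\<close> one-forms. The second summand accounts for the unit, on which
  only the binary product is nonzero.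
\<close>

definition C_inf_weight :: "nat \<Rightarrow> nat \<Rightarrow> 'k::field_char_0 \<times> 'k \<Rightarrow> 'k" where
  "C_inf_weight p q = (\<lambda>(a, b).
     (- 1) ^ (p + 1) * of_nat ((p + q) choose p) * bernoulli (p + q) / fact (p + q) * (a - b) +
     (if p + q = 1 then (- 1) ^ p * b else 0))"

lemma snd_C_inf_taylor:
  assumes "ws \<noteq> []"
  shows "snd (C_inf_taylor ws) =
    (\<Sum>i<length ws. C_inf_weight i (length ws - Suc i) (fst (ws ! i)) *
       (prod_list (map snd (take i ws)) * prod_list (map snd (drop (Suc i) ws))))"
proof -
  consider (1) a b c where "ws = [((a, b), c)]"
    | (2) a b c a' b' c' where "ws = [((a, b), c), ((a', b'), c')]"
    | (3) w1 w2 w3 ws' where "ws = w1 # w2 # w3 # ws'"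
    using assms by (metis list.exhaust prod.exhaust)
  then show ?thesis
  proof cases
    case 1
    then show ?thesis by (simp add: C_inf_taylor_def C_inf_weight_def bernoulli_0)
  next
    case 2
    then show ?thesis
      by (simp add: C_inf_taylor_def C_inf_weight_def bernoulli_1[unfolded One_nat_def] field_simps)
  next
    case 3
    let ?n = "length ws - 1"
    have "snd (C_inf_taylor ws) = (\<Sum>i\<le>?n. (- 1) ^ (i + 1) * of_nat (?n choose i) * bernoulli ?n / fact ?n *
                 (fst (fst (ws ! i)) - snd (fst (ws ! i))) * (\<Prod>j\<in>{..?n} - {i}. snd (ws ! j)))"
      using 3 by (simp add: C_inf_taylor_def Let_def)
    also have "{..?n} = {..<length ws}"
      using 3 by auto
    finally have "snd (C_inf_taylor ws) = (\<Sum>i<length ws. (- 1) ^ (i + 1) * of_nat (?n choose i) * bernoulli ?n / fact ?n *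
                 (fst (fst (ws ! i)) - snd (fst (ws ! i))) * (\<Prod>j\<in>{..<length ws} - {i}. snd (ws ! j)))" .
    also have "\<dots> = (\<Sum>i<length ws. C_inf_weight i (length ws - Suc i) (fst (ws ! i)) *
       (prod_list (map snd (take i ws)) * prod_list (map snd (drop (Suc i) ws))))"
    proof (rule sum.cong[OF refl])
      fix i assume i: "i \<in> {..<length ws}"
      then have "i + (length ws - Suc i) = ?n" "?n \<noteq> 1" "{..<length ws} = {..?n}"
        using 3 by auto
      moreover have "prod_list (map snd (take i ws)) * prod_list (map snd (drop (Suc i) ws)) =
        (\<Prod>j\<in>{..?n} - {i}. snd (ws ! j))"
        using i by (intro prod_list_take_drop) auto
      ultimately show "(- 1) ^ (i + 1) * of_nat (?n choose i) * bernoulli ?n / fact ?n *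
                 (fst (fst (ws ! i)) - snd (fst (ws ! i))) * (\<Prod>j\<in>{..<length ws} - {i}. snd (ws ! j)) =
          C_inf_weight i (length ws - Suc i) (fst (ws ! i)) *
       (prod_list (map snd (take i ws)) * prod_list (map snd (drop (Suc i) ws)))"
        by (simp only: C_inf_weight_def case_prod_beta if_False add_0_right)
    qed
    finally show ?thesis .
  qed
qed

lemma fst_C_inf_taylor:
  "fst (C_inf_taylor ws) = (if length ws = 2
     then (fst (fst (ws ! 0)) * fst (fst (ws ! 1)), snd (fst (ws ! 0)) * snd (fst (ws ! 1))) else 0)"
  by (auto simp: C_inf_taylor_def Let_def zero_prod_def split: list.split)

lemma sum_sum_blocks:
  "(\<Sum>bs\<in>blocks u. \<Sum>cs\<in>blocks v. h (length bs) (length cs) *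
       (prod_list (map F bs) * prod_list (map F cs))) =
   (\<Sum>p\<le>length u. \<Sum>q\<le>length v. h p q * conv_pow (reduced F) p u * conv_pow (reduced F) q v)"
proof -
  have "(\<Sum>bs\<in>blocks u. \<Sum>cs\<in>blocks v. h (length bs) (length cs) *
       (prod_list (map F bs) * prod_list (map F cs))) =
    (\<Sum>bs\<in>blocks u. (\<Sum>cs\<in>blocks v. h (length bs) (length cs) * prod_list (map F cs)) *
       prod_list (map F bs))"
    by (simp add: sum_distrib_left sum_distrib_right mult_ac)
  also have "\<dots> = (\<Sum>bs\<in>blocks u. (\<Sum>q\<le>length v. h (length bs) q * conv_pow (reduced F) q v) *
       prod_list (map F bs))"
    by (simp only: sum_blocks)
  also have "\<dots> = (\<Sum>p\<le>length u. (\<Sum>q\<le>length v. h p q * conv_pow (reduced F) q v) *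
       conv_pow (reduced F) p u)"
    by (rule sum_blocks)
  finally show ?thesis
    by (simp add: sum_distrib_left sum_distrib_right mult_ac)
qed

text \<open>
  The contribution of the unit: one argument of the binary product is the function, so there remains
  a single factor \<open>g\<close>, on one side of it.
\<close>

lemma sum_unit_corner:
  fixes g :: "'a list \<Rightarrow> 'k::comm_ring_1"
  assumes "g [] = 0"
  shows "(\<Sum>p\<le>length u. \<Sum>q\<le>length v.
      (if p + q = 1 then (- 1) ^ p * b else 0) * conv_pow g p u * conv_pow g q v) =
    b * (conv_unit u * g v - g u * conv_unit v)"
proof -
  let ?t = "\<lambda>p q. (if p + q = 1 then (- 1) ^ p * b else 0) * conv_pow g p u * conv_pow g q v"
  have "(\<Sum>p\<le>length u. \<Sum>q\<le>length v. ?t p q) = (\<Sum>p\<le>Suc (length u). \<Sum>q\<le>Suc (length v). ?t p q)"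
  proof (rule sum.mono_neutral_cong_left)
    show "(\<Sum>q\<le>length v. ?t p q) = (\<Sum>q\<le>Suc (length v). ?t p q)" for p
      by (rule sum.mono_neutral_left) (auto simp: conv_pow_vanish[of g, OF assms] not_le)
    show "\<forall>p\<in>{..Suc (length u)} - {..length u}. (\<Sum>q\<le>Suc (length v). ?t p q) = 0"
      by (auto intro!: sum.neutral simp: conv_pow_vanish[of g, OF assms])
  qed auto
  \<comment> \<open>The enlarged range contains both solutions of \<open>p + q = 1\<close>, even if a word is empty.\<close>
  also have "\<dots> = (\<Sum>p\<le>Suc (length u). \<Sum>q\<le>Suc (length v).
      (if q = 1 then if p = 0 then b * conv_unit u * g v else 0 else 0) +
      (if q = 0 then if p = 1 then - b * g u * conv_unit v else 0 else 0))"
  proof (intro sum.cong refl)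
    fix p q :: nat
    have "p = 0 \<and> q = 0 \<or> p = 1 \<and> q = 0 \<or> p = 0 \<and> q = 1 \<or> p + q > 1"
      by arith
    then consider "p = 0" "q = 0" | "p = 1" "q = 0" | "p = 0" "q = 1" | "p + q > 1"
      by blast
    then show "?t p q = (if q = 1 then if p = 0 then b * conv_unit u * g v else 0 else 0) +
      (if q = 0 then if p = 1 then - b * g u * conv_unit v else 0 else 0)"
      by cases auto
  qed
  also have "\<dots> = b * conv_unit u * g v - b * g u * conv_unit v"
    by (simp add: sum.distrib del: sum.atMost_Suc)
  finally show ?thesis by (simp add: algebra_simps)
qed


section \<open>The morphism equation\<close>

text \<open>
  The codifferential of a dg algebra has components of arity 1 and 2 only.
\<close>

lemma sum_subblocks:
  fixes g :: "'v list \<Rightarrow> 'v list \<Rightarrow> 'v list \<Rightarrow> 'w::comm_monoid_add"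
  assumes "\<And>us vs ws. length vs \<ge> 3 \<Longrightarrow> g us vs ws = 0"
  shows "(\<Sum>(us, vs, ws)\<in>subblocks xs. g us vs ws) =
    (\<Sum>i<length xs. g (take i xs) [xs ! i] (drop (Suc i) xs)) +
    (\<Sum>i<length xs - 1. g (take i xs) [xs ! i, xs ! Suc i] (drop (i + 2) xs))"
proof -
  let ?f = "\<lambda>i. (take i xs, [xs ! i], drop (Suc i) xs)"
  let ?h = "\<lambda>i. (take i xs, [xs ! i, xs ! Suc i], drop (i + 2) xs)"
  let ?A = "?f ` {..<length xs}" and ?B = "?h ` {..<length xs - 1}"
  have fin: "finite (subblocks xs)"
  proof (rule finite_subset)
    show "subblocks xs \<subseteq> (\<lambda>(i, j). (take i xs, take j (drop i xs), drop (i + j) xs)) `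
        ({..length xs} \<times> {..length xs})"
    proof (rule subsetI, clarify)
      fix us vs ws assume "(us, vs, ws) \<in> subblocks xs"
      then show "(us, vs, ws) \<in> (\<lambda>(i, j). (take i xs, take j (drop i xs), drop (i + j) xs)) `
        ({..length xs} \<times> {..length xs})"
        by (intro image_eqI[of _ _ "(length us, length vs)"]) (auto simp: subblocks_def)
    qed
  qed simp
  have sub: "?A \<union> ?B \<subseteq> subblocks xs"
  proof -
    have "take i xs @ xs ! i # xs ! Suc i # drop (Suc (Suc i)) xs = xs" if "i < length xs - 1" for i
      using that by (metis Cons_nth_drop_Suc Suc_lessD append_take_drop_id less_diff_conv
          Suc_eq_plus1)
    then show ?thesis
      by (auto simp: subblocks_def id_take_nth_drop[symmetric])
  qed
  have rest: "g us vs ws = 0" if "(us, vs, ws) \<in> subblocks xs - (?A \<union> ?B)" for us vs ws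
  proof (rule assms, rule ccontr)
    assume "\<not> 3 \<le> length vs"
    moreover have xs: "us @ vs @ ws = xs" "vs \<noteq> []"
      using that by (auto simp: subblocks_def)
    ultimately consider v where "vs = [v]" | v v' where "vs = [v, v']"
      by (cases vs rule: list.exhaust; cases "tl vs"; cases "tl (tl vs)") auto
    then show False
    proof cases
      case 1
      then have "(us, vs, ws) = ?f (length us)" "length us \<in> {..<length xs}"
        using xs by auto
      then have "(us, vs, ws) \<in> ?A" by (rule image_eqI)
      then show False using that by blast
    next
      case 2
      then have "(us, vs, ws) = ?h (length us)" "length us \<in> {..<length xs - 1}"
        using xs by (auto simp: nth_append)
      then have "(us, vs, ws) \<in> ?B" by (rule image_eqI)
      then show False using that by blast
    qed
  qed
  have inj: "inj_on ?f {..<length xs}" "inj_on ?h {..<length xs - 1}"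
    by (auto intro!: inj_onI dest!: arg_cong[where f = length])
  have "(\<Sum>(us, vs, ws)\<in>subblocks xs. g us vs ws) = (\<Sum>(us, vs, ws)\<in>?A \<union> ?B. g us vs ws)"
  proof (rule sum.mono_neutral_right[OF fin sub], rule ballI)
    fix a assume "a \<in> subblocks xs - (?A \<union> ?B)"
    then show "(case a of (us, vs, ws) \<Rightarrow> g us vs ws) = 0"
      using rest by (cases a) (simp only: case_prod_conv)
  qed
  also have "\<dots> = (\<Sum>(us, vs, ws)\<in>?A. g us vs ws) + (\<Sum>(us, vs, ws)\<in>?B. g us vs ws)"
    by (rule sum.union_disjoint) auto
  finally show ?thesis
    unfolding sum.reindex[OF inj(1)] sum.reindex[OF inj(2)] by (simp add: o_def)
qed

context interval_calculus
begin

text \<open>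
  The value of \<open>L\<close> on the words obtained by multiplying two neighbouring letters. All letters may be
  inhomogeneous, and the product of two letters consists of the two contractions of a function
  into a one-form.
\<close>

definition Q2_sum :: "('f \<times> 'f) list \<Rightarrow> 'k" where
  "Q2_sum xs = (\<Sum>i<length xs - 1. L (map snd (take i xs) @
     (fst (xs ! i) * snd (xs ! Suc i) - snd (xs ! i) * fst (xs ! Suc i)) # map snd (drop (i + 2) xs)))"

text \<open>
  Every letter is the sum of a function and a one-form; the codifferential of an inhomogeneous word is
  the sum over the choices of the letter whose function part is used.
\<close>

lemma sum_boundary:
  assumes "xs \<noteq> []"
  shows "(\<Sum>i<length xs.
        boundary (deriv_fn M) L (map snd (take i xs)) (fst (xs ! i)) (map snd (drop (Suc i) xs))) =
     (\<Sum>i<length xs. L (map snd (take i xs) @ (- deriv_fn M (fst (xs ! i))) # map snd (drop (Suc i) xs)))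
     + Q2_sum xs"
proof -
  obtain k where k: "length xs = Suc k"
    using assms by (cases xs) auto
  let ?u = "\<lambda>i. map snd (take i xs)" and ?v = "\<lambda>i. map snd (drop (Suc i) xs)"
  let ?f = "\<lambda>i. fst (xs ! i)" and ?a = "\<lambda>i. snd (xs ! i)"
  let ?X = "\<lambda>i. if ?u i = [] then 0 else L (butlast (?u i) @ (last (?u i) * ?f i) # ?v i)"
  let ?Y = "\<lambda>i. if ?v i = [] then 0 else L (?u i @ (?f i * hd (?v i)) # tl (?v i))"
  have "(\<Sum>i<Suc k. ?X i) = (\<Sum>i<k. ?X (Suc i))"
    by (subst sum.lessThan_Suc_shift) simp
  also have "\<dots> = (\<Sum>i<k. L (?u i @ (?a i * ?f (Suc i)) # ?v (Suc i)))"
  proof (rule sum.cong[OF refl])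
    fix i assume "i \<in> {..<k}"
    then have "?u (Suc i) = ?u i @ [?a i]"
      using k by (simp add: take_Suc_conv_app_nth)
    then show "?X (Suc i) = L (?u i @ (?a i * ?f (Suc i)) # ?v (Suc i))"
      by simp
  qed
  finally have X: "(\<Sum>i<Suc k. ?X i) = (\<Sum>i<k. L (?u i @ (?a i * ?f (Suc i)) # ?v (Suc i)))" .
  have "(\<Sum>i<Suc k. ?Y i) = (\<Sum>i<k. ?Y i)"
    using k by simp
  also have "\<dots> = (\<Sum>i<k. L (?u i @ (?f i * ?a (Suc i)) # ?v (Suc i)))"
  proof (rule sum.cong[OF refl])
    fix i assume "i \<in> {..<k}"
    then have "?v i = ?a (Suc i) # ?v (Suc i)"
      using k by (simp flip: Cons_nth_drop_Suc)
    then show "?Y i = L (?u i @ (?f i * ?a (Suc i)) # ?v (Suc i))"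
      by simp
  qed
  finally have Y: "(\<Sum>i<Suc k. ?Y i) = (\<Sum>i<k. L (?u i @ (?f i * ?a (Suc i)) # ?v (Suc i)))" .
  have "(\<Sum>i<length xs. boundary (deriv_fn M) L (?u i) (?f i) (?v i)) =
      (\<Sum>i<length xs. - L (?u i @ deriv_fn M (?f i) # ?v i)) - (\<Sum>i<Suc k. ?X i) + (\<Sum>i<Suc k. ?Y i)"
    unfolding boundary_def k by (simp only: sum.distrib sum_subtractf)
  then show ?thesis
    unfolding X Y Q2_sum_def by (simp add: k L_diff L_minus sum_subtractf)
qed

text \<open>
  Each summand of the structure on Whitney forms uses the function part of one argument, which is
  nonzero only if the block of this argument has length 1. The blocks before and after it sum up to
  powers of \<open>L\<close>, and the formula for \<open>boundary L\<close> has the same coefficients.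
\<close>

lemma sum_C_inf_taylor:
  assumes "xs \<noteq> []"
  shows "snd (A_inf_compose C_inf_taylor (phi M) xs) = (\<Sum>i<length xs.
    boundary (deriv_fn M) L (map snd (take i xs)) (fst (xs ! i)) (map snd (drop (Suc i) xs)))"
proof -
  let ?F = "\<lambda>ys. L (map snd ys)"
  let ?pt = "\<lambda>x :: 'f \<times> 'f. (eval_fn M (fst x) 1, eval_fn M (fst x) 0)"
  let ?\<Phi> = "\<lambda>bs x cs. C_inf_weight (length bs) (length cs) (?pt x) *
    (prod_list (map ?F bs) * prod_list (map ?F cs))"
  have "snd (C_inf_taylor (map (phi M) yss)) = (\<Sum>i<length yss.
      if length (yss ! i) = 1 then ?\<Phi> (take i yss) (hd (yss ! i)) (drop (Suc i) yss) else 0)"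
    if "yss \<in> blocks xs" for yss
  proof -
    have ne: "yss \<noteq> []" "\<And>ys. ys \<in> set yss \<Longrightarrow> ys \<noteq> []"
      using that assms by (auto simp: blocks_def)
    have maps: "map snd (map (phi M) (take i yss)) = map ?F (take i yss)"
      "map snd (map (phi M) (drop i yss)) = map ?F (drop i yss)" for i
      using ne(2) by (auto dest: in_set_takeD in_set_dropD simp: snd_phi)
    have "snd (C_inf_taylor (map (phi M) yss)) = (\<Sum>i<length yss.
        C_inf_weight i (length yss - Suc i) (fst (phi M (yss ! i))) *
        (prod_list (map ?F (take i yss)) * prod_list (map ?F (drop (Suc i) yss))))"
    proof -
      have "snd (C_inf_taylor (map (phi M) yss)) = (\<Sum>i<length yss.
          C_inf_weight i (length yss - Suc i) (fst (map (phi M) yss ! i)) *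
          (prod_list (map ?F (take i yss)) * prod_list (map ?F (drop (Suc i) yss))))"
        using snd_C_inf_taylor[of "map (phi M) yss"] ne(1)
        by (simp only: take_map drop_map maps length_map map_is_Nil_conv simp_thms)
      then show ?thesis by simp
    qed
    also have "\<dots> = (\<Sum>i<length yss.
      if length (yss ! i) = 1 then ?\<Phi> (take i yss) (hd (yss ! i)) (drop (Suc i) yss) else 0)"
    proof (rule sum.cong[OF refl])
      fix i assume i: "i \<in> {..<length yss}"
      show "C_inf_weight i (length yss - Suc i) (fst (phi M (yss ! i))) *
        (prod_list (map ?F (take i yss)) * prod_list (map ?F (drop (Suc i) yss))) =
        (if length (yss ! i) = 1 then ?\<Phi> (take i yss) (hd (yss ! i)) (drop (Suc i) yss) else 0)"
      proof (cases "length (yss ! i) = 1")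
        case True
        then obtain x where "yss ! i = [x]" by (auto simp: length_Suc_conv)
        then show ?thesis using i by (simp add: phi_single dupont_pi_eq min_def)
      next
        case False
        moreover have "yss ! i \<noteq> []" using ne(2) i by simp
        ultimately have "length (yss ! i) \<ge> 2"
          by (cases "length (yss ! i)") auto
        then have "fst (phi M (yss ! i)) = (0, 0)" by (simp add: fst_phi zero_prod_def)
        then show ?thesis using False by (simp add: C_inf_weight_def)
      qed
    qed
    finally show ?thesis .
  qed
  then have "snd (A_inf_compose C_inf_taylor (phi M) xs) = (\<Sum>yss\<in>blocks xs. \<Sum>i<length yss.
      if length (yss ! i) = 1 then ?\<Phi> (take i yss) (hd (yss ! i)) (drop (Suc i) yss) else 0)"
    unfolding A_inf_compose_def snd_sum by (rule sum.cong[OF refl])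
  also have "\<dots> = (\<Sum>i<length xs. \<Sum>bs\<in>blocks (take i xs). \<Sum>cs\<in>blocks (drop (Suc i) xs).
      ?\<Phi> bs (xs ! i) cs)"
    by (rule sum_blocks_marked)
  also have "\<dots> = (\<Sum>i<length xs.
    boundary (deriv_fn M) L (map snd (take i xs)) (fst (xs ! i)) (map snd (drop (Suc i) xs)))"
  proof (rule sum.cong[OF refl])
    fix i
    let ?u = "map snd (take i xs)" and ?v = "map snd (drop (Suc i) xs)" and ?f = "fst (xs ! i)"
    let ?a = "eval_fn M ?f 1" and ?b = "eval_fn M ?f 0"
    have red: "reduced ?F = ?F" by (auto simp: reduced_def)
    have weight: "C_inf_weight p q (?a, ?b) =
      - ((?a - ?b) * ((- 1) ^ p * bernoulli (p + q) / (fact p * fact q))) +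
      (if p + q = 1 then (- 1) ^ p * ?b else 0)" for p q
      by (simp add: C_inf_weight_def binomial_fact field_simps)
    have "(\<Sum>bs\<in>blocks (take i xs). \<Sum>cs\<in>blocks (drop (Suc i) xs). ?\<Phi> bs (xs ! i) cs) =
      (\<Sum>p\<le>length ?u. \<Sum>q\<le>length ?v. C_inf_weight p q (?a, ?b) * conv_pow L p ?u * conv_pow L q ?v)"
      by (subst sum_sum_blocks) (simp only: red conv_pow_map[of L snd] length_map)
    also have "\<dots> = - (?a - ?b) * (\<Sum>p\<le>length ?u. \<Sum>q\<le>length ?v.
        (- 1) ^ p * bernoulli (p + q) / (fact p * fact q) * conv_pow L p ?u * conv_pow L q ?v) +
       (\<Sum>p\<le>length ?u. \<Sum>q\<le>length ?v.
        (if p + q = 1 then (- 1) ^ p * ?b else 0) * conv_pow L p ?u * conv_pow L q ?v)"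
      unfolding weight distrib_right sum.distrib sum_distrib_left
      by (intro arg_cong2[of _ _ _ _ "(+)"] sum.cong refl) (simp_all only: minus_mult_left mult.assoc)
    also have "\<dots> = boundary (deriv_fn M) L ?u ?f ?v"
      unfolding sum_unit_corner[of L, OF L_Nil] boundary_L
      by (simp only: minus_mult_left[symmetric] diff_conv_add_uminus add.commute)
    finally show "(\<Sum>bs\<in>blocks (take i xs). \<Sum>cs\<in>blocks (drop (Suc i) xs). ?\<Phi> bs (xs ! i) cs) =
       boundary (deriv_fn M) L ?u ?f ?v" .
  qed
  finally show ?thesis .
qed

lemma snd_koszul [simp]: "snd (koszul x) = snd x"
  by (simp add: koszul_def)

lemma Omega_Q2_eq: "Omega_Q2 x y = (fst x * fst y, fst x * snd y - snd x * fst y)"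
  by (simp add: Omega_Q2_def form_mult_def koszul_def)

lemma map_snd_koszul [simp]: "map (snd \<circ> koszul) us = map snd us"
  by simp

lemma sum_subblocks_phi:
  "(\<Sum>(us, vs, ws)\<in>subblocks xs. phi M (map koszul us @ taylor (Omega M) vs # ws)) =
   (\<Sum>i<length xs. phi M (map koszul (take i xs) @ (- form_diff M (xs ! i)) # drop (Suc i) xs)) +
   precomp_Q (phi M) xs"
proof -
  have "taylor (Omega M) vs = 0" if "length vs \<ge> 3" for vs
    using that by (auto simp: Omega_def split: list.split)
  then show ?thesis
    unfolding precomp_Q_def by (subst sum_subblocks) (simp_all add: phi_zero Omega_def)
qed

lemma snd_precomp_Q_phi: "snd (precomp_Q (phi M) xs) = Q2_sum xs"
  unfolding precomp_Q_def Q2_sum_def snd_sum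
  by (simp add: snd_phi Omega_Q2_eq)

lemma fst_precomp_Q_phi:
  assumes "xs \<noteq> []"
  shows "fst (precomp_Q (phi M) xs) = (case xs of
    [x, y] \<Rightarrow> (eval_fn M (fst x * fst y) 1, eval_fn M (fst x * fst y) 0) | _ \<Rightarrow> 0)"
proof -
  consider x where "xs = [x]" | x y where "xs = [x, y]" | x y z ws where "xs = x # y # z # ws"
    using assms by (metis list.exhaust)
  then show ?thesis
  proof cases
    case 3
    have "fst (phi M (map koszul (take i xs) @ Omega_Q2 (xs ! i) (xs ! Suc i) # drop (i + 2) xs)) = 0"
      if "i < length xs - 1" for i
      by (rule fst_phi) (use that 3 in auto)
    then have "fst (precomp_Q (phi M) xs) = 0"
      unfolding precomp_Q_def fst_sum by (intro sum.neutral) simp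
    then show ?thesis using 3 by simp
  qed (simp_all add: precomp_Q_def phi_single dupont_pi_eq Omega_Q2_eq)
qed

text \<open>
  Only the binary product of Whitney forms can be a function, and only if both arguments are; so both
  blocks have length 1.
\<close>

lemma fst_A_inf_compose:
  assumes "xs \<noteq> []"
  shows "fst (A_inf_compose C_inf_taylor (phi M) xs) = (case xs of
    [x, y] \<Rightarrow> (eval_fn M (fst x * fst y) 1, eval_fn M (fst x * fst y) 0) | _ \<Rightarrow> 0)"
proof -
  let ?t = "\<lambda>yss. fst (C_inf_taylor (map (phi M) yss))"
  have zero: "?t yss = 0" if "yss \<in> blocks xs" "\<not> (\<exists>x y. yss = [[x], [y]])" for yss
  proof (rule ccontr)
    assume nz: "?t yss \<noteq> 0"
    then have "length yss = 2" by (auto simp: fst_C_inf_taylor split: if_splits)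
    then obtain ys zs where yss: "yss = [ys, zs]"
      by (auto simp: length_Suc_conv numeral_2_eq_2)
    then have "length ys = 1" "length zs = 1"
    proof -
      have "length ys < 2" "length zs < 2"
        using nz fst_phi[of ys] fst_phi[of zs]
        by (force simp: fst_C_inf_taylor yss zero_prod_def not_less)+
      moreover have "ys \<noteq> []" "zs \<noteq> []" using that(1) yss by (auto simp: blocks_def)
      ultimately show "length ys = 1" "length zs = 1"
        by (cases ys; cases zs; auto)+
    qed
    then show False using that(2) yss by (auto simp: length_Suc_conv)
  qed
  show ?thesis
  proof (cases "\<exists>x y. xs = [x, y]")
    case True
    then obtain x y where xs: "xs = [x, y]" by blast
    have "(\<Sum>yss\<in>blocks xs. ?t yss) = (\<Sum>yss\<in>{[[x], [y]]}. ?t yss)"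
      by (rule sum.mono_neutral_right[OF finite_blocks])
        (auto simp: blocks_def xs intro!: zero)
    then show ?thesis
      by (simp add: A_inf_compose_def fst_sum xs fst_C_inf_taylor phi_single dupont_pi_eq eval_mult)
  next
    case False
    have "?t yss = 0" if "yss \<in> blocks xs" for yss
    proof (rule zero[OF that], intro notI, elim exE)
      fix x y assume "yss = [[x], [y]]"
      with that have "xs = [x, y]" by (simp add: blocks_def)
      with False show False by blast
    qed
    then show ?thesis
      using False by (auto simp: A_inf_compose_def fst_sum split: list.split)
  qed
qed

lemma phi_morphism_equation:
  assumes "xs \<noteq> []"
  shows "(\<Sum>(us, vs, ws)\<in>subblocks xs. phi M (map koszul us @ taylor (Omega M) vs # ws)) =
    A_inf_compose C_inf_taylor (phi M) xs"
proof (rule prod_eqI)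
  show "snd (\<Sum>(us, vs, ws)\<in>subblocks xs. phi M (map koszul us @ taylor (Omega M) vs # ws)) =
      snd (A_inf_compose C_inf_taylor (phi M) xs)"
    unfolding sum_subblocks_phi sum_C_inf_taylor[OF assms] sum_boundary[OF assms] snd_add
      snd_precomp_Q_phi
    by (simp add: snd_sum snd_phi form_diff_def)
  show "fst (\<Sum>(us, vs, ws)\<in>subblocks xs. phi M (map koszul us @ taylor (Omega M) vs # ws)) =
      fst (A_inf_compose C_inf_taylor (phi M) xs)"
  proof -
    have d: "fst (phi M (map koszul us @ (- form_diff M x) # ws)) = 0" for us x ws
    proof (cases "us @ ws = []")
      case True
      then show ?thesis by (simp add: phi_single dupont_pi_eq form_diff_def eval_zero zero_prod_def)
    next
      case False
      then have "length (map koszul us @ (- form_diff M x) # ws) \<ge> 2" by (cases us; cases ws) auto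
      then show ?thesis by (rule fst_phi)
    qed
    show ?thesis
      unfolding sum_subblocks_phi fst_A_inf_compose[OF assms] fst_add fst_precomp_Q_phi[OF assms] fst_sum d by simp
  qed
qed

end

lemma length_ge_2_iff: "length (us @ x # ws) \<ge> 2 \<longleftrightarrow> us @ ws \<noteq> []"
  by (cases us; cases ws) auto

lemma vector_space_C_inf: "vector_space (smul (C_inf :: ('k::field_char_0, 'k whitney) A_infinity))"
  by unfold_locales (auto simp: C_inf_def algebra_simps)

lemma smul_C_inf: "smul C_inf c w = ((c * fst (fst w), c * snd (fst w)), c * snd w)"
  by (simp add: C_inf_def split: prod.split)

lemma taylor_C_inf: "taylor C_inf = C_inf_taylor"
  by (simp add: C_inf_def)

text \<open>
  All words in a shuffle product have the same letters.
\<close>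

lemma shuffle_sum_eq_0:
  assumes "\<And>zs. length zs = length xs + length ys \<Longrightarrow> z \<in> set zs \<Longrightarrow> F zs = 0" "z \<in> set xs \<union> set ys"
  shows "shuffle_sum F xs ys = 0"
proof -
  have "shuffle_sum F xs ys = 0" if "\<And>zs. mset zs = mset xs + mset ys \<Longrightarrow> F zs = 0" for F xs ys
    using that
  proof (induction F xs ys rule: shuffle_sum.induct)
    case (3 F x xs y ys)
    have "shuffle_sum (\<lambda>zs. F (x # zs)) xs (y # ys) = 0"
      by (rule 3(1)) (simp add: 3(4))
    moreover have "shuffle_sum (\<lambda>zs. F (y # zs)) (x # xs) ys = 0"
      by (cases "susp_odd y \<and> odd (length (filter susp_odd (x # xs)))")
        (rule 3(2) 3(3), assumption, simp add: 3(4))+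
    ultimately show ?case by simp
  qed simp_all
  moreover have "F zs = 0" if "mset zs = mset xs + mset ys" for zs
    using assms that by (metis mset_append set_append set_mset_mset size_mset size_union)
  ultimately show ?thesis by blast
qed

lemma shuffle_sum_even:
  fixes F :: "('a::zero \<times> 'b) list \<Rightarrow> 'c::ab_group_add \<times> 'k::ab_group_add"
  assumes "\<And>zs. length zs = length xs + length ys \<Longrightarrow> F zs = (0, G (map snd zs))"
    and "\<And>y. y \<in> set ys \<Longrightarrow> \<not> susp_odd y"
  shows "shuffle_sum F xs ys = (0, shuffle_add G (map snd xs) (map snd ys))"
  using assms
proof (induction F xs ys arbitrary: G rule: shuffle_sum.induct)
  case (3 F x xs y ys)
  have y: "\<not> susp_odd y" using 3(5) by simp
  have "shuffle_sum (\<lambda>zs. F (x # zs)) xs (y # ys) =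
      (0, shuffle_add (\<lambda>zs. G (snd x # zs)) (map snd xs) (map snd (y # ys)))"
    by (rule 3(1)) (use 3(4,5) in auto)
  moreover have "shuffle_sum (\<lambda>zs. F (y # zs)) (x # xs) ys =
      (0, shuffle_add (\<lambda>zs. G (snd y # zs)) (map snd (x # xs)) (map snd ys))"
    by (rule 3(3)) (use 3(4,5) y in auto)
  ultimately show ?case using y by simp
qed simp_all

section \<open>The morphism property of \<open>\<phi>\<close>\<close>

context interval_calculus
begin

lemma smul_Omega: "smul (Omega M) c x = (scale_fn M c (fst x), scale_fn M c (snd x))"
  by (simp add: Omega_def)

lemma vector_space_Omega: "vector_space (smul (Omega M))"
  by unfold_locales
    (simp_all add: smul_Omega prod_eq_iff scale.scale_right_distrib scale.scale_left_distrib)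

lemma multilinear_phi: "multilinear (smul (Omega M)) (smul C_inf) (phi M)"
  unfolding multilinear_iff[OF vector_space_Omega vector_space_C_inf]
proof (intro conjI allI)
  fix us vs :: "('f \<times> 'f) list" and x y c
  have "phi M (us @ (x + y) # vs) = phi M (us @ x # vs) + phi M (us @ y # vs) \<and>
     phi M (us @ smul (Omega M) c x # vs) = smul C_inf c (phi M (us @ x # vs))"
  proof (cases "us @ vs = []")
    case True
    have "I [a + b] = I [a] + I [b]" "I [scale_fn M k a] = k * I [a]" for a b k
      using L_add[of "[]" a b "[]"] L_scale[of "[]" k a "[]"] by simp_all
    then show ?thesis
      using True by (simp add: phi_single dupont_pi_eq smul_C_inf smul_Omega eval_add eval_scale)
  next
    case False
    then have "length (us @ z # vs) \<ge> 2" for z :: "'f \<times> 'f"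
      by (simp only: length_ge_2_iff simp_thms)
    then show ?thesis
      by (simp add: phi_eqI smul_C_inf smul_Omega L_add L_scale zero_prod_def del: length_append)
  qed
  then show "phi M (us @ (x + y) # vs) = phi M (us @ x # vs) + phi M (us @ y # vs)"
    "phi M (us @ smul (Omega M) c x # vs) = smul C_inf c (phi M (us @ x # vs))" by auto
qed

lemma phi_zero_snd: "length xs \<ge> 2 \<Longrightarrow> x \<in> set xs \<Longrightarrow> snd x = 0 \<Longrightarrow> phi M xs = 0"
  by (simp add: phi_eqI zero_prod_def) (metis L_zero_mem image_eqI list.set_map)

lemma degree_zero_phi: "degree_zero (phi M)"
  unfolding degree_zero_def
proof (intro allI impI)
  fix xs :: "('f \<times> 'f) list" and ds
  assume ne: "xs \<noteq> []" and ds: "list_all2 (\<lambda>x d. x \<in> susp_part d) xs ds"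
  consider x where "xs = [x]" | "length xs \<ge> 2"
    using ne by (cases xs rule: list.exhaust; cases "tl xs") auto
  then show "phi M xs \<in> susp_part (sum_list ds)"
  proof cases
    case 1
    then obtain d where "ds = [d]" "x \<in> susp_part d"
      using ds by (auto simp: list_all2_Cons1)
    moreover have "I [0] = 0" using L_zero[of "[]" "[]"] by simp
    ultimately show ?thesis
      using 1 by (auto simp: susp_part_def phi_single dupont_pi_eq eval_zero zero_prod_def
          split: if_splits)
  next
    case 2
    show ?thesis
    proof (cases "\<exists>x\<in>set xs. snd x = 0")
      case True
      then have "phi M xs = 0" using phi_zero_snd 2 by blast
      then show ?thesis by (simp add: susp_part_def)
    next
      case False
      have "sum_list ds = 0"
        using ds False
        by (induction rule: list_all2_induct) (auto simp: susp_part_def split: if_splits)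
      then show ?thesis using 2 by (simp add: susp_part_def fst_phi)
    qed
  qed
qed

text \<open>
  If a letter is a function, \<open>\<phi>\<close> vanishes on every word of the shuffle product. Otherwise all
  letters are one-forms, which are even in the suspension.
\<close>

theorem C_infinity_morphism_phi: "C_infinity_morphism (Omega M) C_inf (phi M)"
  unfolding C_infinity_morphism_def A_infinity_morphism_def taylor_C_inf
proof (intro conjI allI impI multilinear_phi degree_zero_phi phi_morphism_equation)
  fix xs ys :: "('f \<times> 'f) list"
  assume ne: "xs \<noteq> []" "ys \<noteq> []" and hom: "\<forall>z\<in>set (xs @ ys). fst z = 0 \<or> snd z = 0"
  have len: "length zs \<ge> 2" if "length zs = length xs + length ys" for zs :: "('f \<times> 'f) list"
    using that ne by (cases xs; cases ys) auto
  show "shuffle_sum (phi M) xs ys = 0"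
  proof (cases "\<exists>z\<in>set xs \<union> set ys. snd z = 0")
    case True
    then obtain z where "z \<in> set xs \<union> set ys" "snd z = 0" by blast
    then show ?thesis
      using phi_zero_snd[OF len] by (intro shuffle_sum_eq_0[of xs ys z]) auto
  next
    case False
    then have "\<not> susp_odd y" if "y \<in> set ys" for y
      using hom that by (auto simp: susp_odd_def)
    then have "shuffle_sum (phi M) xs ys = (0, shuffle_add L (map snd xs) (map snd ys))"
      by (intro shuffle_sum_even) (auto intro: phi_eqI[OF len])
    then show ?thesis
      using ne by (simp add: L_def conv_log_shuffle[OF character_I] zero_prod_def)
  qed
qed


section \<open>The transferred morphism\<close>

lemma boundary_L_zero:
  assumes "0 \<in> set u \<union> set v"
  shows "boundary (deriv_fn M) L u f v = 0"
  using assms by (cases u rule: rev_cases; cases v) (auto simp: boundary_def L_zero_mem)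

text \<open>
  The letter \<open>i\<close> is a function \<open>f\<close> that vanishes at both ends, so \<open>boundary L\<close> is zero at \<open>i\<close>, and
  the products of \<open>f\<close> with its neighbours add up to the term with \<open>f'\<close>. At the other
  positions everything vanishes, as the word retains the letter \<open>f\<close> without one-form part.
\<close>

lemma precomp_Q_phi_acyclic:
  assumes "length ys \<ge> 2" "i < length ys" "snd (ys ! i) = 0"
    and ends: "eval_fn M (fst (ys ! i)) 0 = 0" "eval_fn M (fst (ys ! i)) 1 = 0"
  shows "precomp_Q (phi M) ys =
    (0, L (map snd (take i ys) @ deriv_fn M (fst (ys ! i)) # map snd (drop (Suc i) ys)))"
proof (rule prod_eqI)
  have ne: "ys \<noteq> []" using assms(1) by auto
  show "fst (precomp_Q (phi M) ys) =
    fst (0, L (map snd (take i ys) @ deriv_fn M (fst (ys ! i)) # map snd (drop (Suc i) ys)))"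
  proof (cases "\<exists>x y. ys = [x, y]")
    case True
    then obtain x y where ys: "ys = [x, y]" by blast
    then have "i = 0 \<or> i = 1" using assms(2) by auto
    then show ?thesis
      using ends by (auto simp: fst_precomp_Q_phi ys eval_mult zero_prod_def)
  next
    case False
    then show ?thesis by (auto simp: fst_precomp_Q_phi[OF ne] split: list.split)
  qed
  let ?u = "\<lambda>j. map snd (take j ys)" and ?v = "\<lambda>j. map snd (drop (Suc j) ys)"
    and ?f = "\<lambda>j. fst (ys ! j)"
  have zero: "0 \<in> set (?u j) \<union> set (?v j)" if "j < length ys" "j \<noteq> i" for j
  proof (cases "i < j")
    case True
    then have "ys ! i \<in> set (take j ys)"
      using assms(2) that by (auto simp: in_set_conv_nth intro!: exI[of _ i])
    then show ?thesis using assms(3) by force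
  next
    case False
    then have "ys ! i \<in> set (drop (Suc j) ys)"
      using assms(2) that by (auto simp: in_set_conv_nth intro!: exI[of _ "i - Suc j"])
    then show ?thesis using assms(3) by force
  qed
  have "boundary (deriv_fn M) L (?u j) (?f j) (?v j) = 0" if "j < length ys" for j
  proof (cases "j = i")
    case True
    then show ?thesis using ends by (simp add: boundary_L)
  next
    case False
    then show ?thesis using zero that by (intro boundary_L_zero)
  qed
  then have "Q2_sum ys = - (\<Sum>j<length ys. L (?u j @ (- deriv_fn M (?f j)) # ?v j))"
    using sum_boundary[OF ne] by (simp add: eq_neg_iff_add_eq_0 add.commute)
  also have "(\<Sum>j<length ys. L (?u j @ (- deriv_fn M (?f j)) # ?v j)) =
      (\<Sum>j<length ys. if j = i then - L (?u j @ deriv_fn M (?f j) # ?v j) else 0)"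
  proof (rule sum.cong[OF refl])
    fix j assume j: "j \<in> {..<length ys}"
    show "L (?u j @ (- deriv_fn M (?f j)) # ?v j) =
        (if j = i then - L (?u j @ deriv_fn M (?f j) # ?v j) else 0)"
    proof (cases "j = i")
      case True
      then show ?thesis by (simp only: L_minus if_True refl)
    next
      case False
      with j have "0 \<in> set (?u j) \<union> set (?v j)"
        by (intro zero) simp_all
      then have "0 \<in> set (?u j @ (- deriv_fn M (?f j)) # ?v j)"
        by (simp only: set_append list.set) blast
      with False show ?thesis
        by (simp only: L_zero_mem if_False)
    qed
  qed
  also have "\<dots> = - L (?u i @ deriv_fn M (?f i) # ?v i)"
    using assms(2) by simp
  finally show "snd (precomp_Q (phi M) ys) =
    snd (0, L (?u i @ deriv_fn M (?f i) # ?v i))"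
    by (simp add: snd_precomp_Q_phi)
qed

lemma dupont_h_eq: "dupont_h M x = (scale_fn M (I [snd x]) (coord M) - primitive M (snd x), 0)"
  by (simp add: dupont_h_def integral01_def I_eq split: prod.split)

lemma snd_iota_dupont_pi: "snd (iota M (dupont_pi M x)) = scale_fn M (I [snd x]) 1"
  by (simp add: iota_def dupont_pi_eq)

text \<open>
  The summands form a telescoping sum: the first \<open>i\<close> letters of the word are the given ones, the
  later ones are replaced by their projections, and \<open>d(-h(x))\<close> is \<open>x\<close> minus its projection.
\<close>

lemma precomp_H_phi:
  assumes "length xs \<ge> 2"
  shows "precomp_H M (precomp_Q (phi M)) xs = phi M xs"
proof -
  let ?c = "\<lambda>x. scale_fn M (I [snd x]) 1"
  let ?S = "\<lambda>i. L (map snd (take i xs) @ map ?c (drop i xs))"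
  have summand: "precomp_Q (phi M) (map koszul (take i xs) @ (- dupont_h M (xs ! i)) #
      map (iota M \<circ> dupont_pi M) (drop (Suc i) xs)) = (0, ?S (Suc i) - ?S i)"
    if i: "i < length xs" for i
  proof -
    let ?ys = "map koszul (take i xs) @ (- dupont_h M (xs ! i)) #
      map (iota M \<circ> dupont_pi M) (drop (Suc i) xs)"
    have nth: "?ys ! i = - dupont_h M (xs ! i)"
      using i by (simp add: nth_append)
    have "precomp_Q (phi M) ?ys =
       (0, L (map snd (take i ?ys) @ deriv_fn M (fst (?ys ! i)) # map snd (drop (Suc i) ?ys)))"
    proof (rule precomp_Q_phi_acyclic)
      show "length ?ys \<ge> 2" "i < length ?ys" using assms i by auto
      show "snd (?ys ! i) = 0" unfolding nth by (simp add: dupont_h_eq)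
      show "eval_fn M (fst (?ys ! i)) 0 = 0" "eval_fn M (fst (?ys ! i)) 1 = 0"
        unfolding nth
        by (simp_all add: dupont_h_eq eval_minus eval_diff eval_scale coord_0 coord_1 primitive_0 I_eq)
    qed
    moreover have "map snd (take i ?ys) = map snd (take i xs)"
      using i by simp
    moreover have "map snd (drop (Suc i) ?ys) = map ?c (drop (Suc i) xs)"
      using i by (simp add: snd_iota_dupont_pi)
    moreover have "deriv_fn M (fst (?ys ! i)) = snd (xs ! i) - ?c (xs ! i)"
      unfolding nth
      by (simp add: dupont_h_eq deriv_minus deriv_diff deriv_scale deriv_coord deriv_primitive)
    ultimately have "precomp_Q (phi M) ?ys = (0, L (map snd (take i xs) @
        (snd (xs ! i) - ?c (xs ! i)) # map ?c (drop (Suc i) xs)))"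
      by (simp only:)
    moreover have "map snd (take (Suc i) xs) = map snd (take i xs) @ [snd (xs ! i)]"
      using i by (simp add: take_Suc_conv_app_nth)
    moreover have "map ?c (drop i xs) = ?c (xs ! i) # map ?c (drop (Suc i) xs)"
      using i by (simp flip: Cons_nth_drop_Suc)
    ultimately show ?thesis
      by (simp add: L_diff)
  qed
  have "precomp_H M (precomp_Q (phi M)) xs = (\<Sum>i<length xs. (0, ?S (Suc i) - ?S i))"
    unfolding precomp_H_def by (intro sum.cong refl) (simp only: summand lessThan_iff)
  also have "\<dots> = (0, \<Sum>i<length xs. ?S (Suc i) - ?S i)"
    by (simp add: prod_eq_iff fst_sum snd_sum)
  also have "(\<Sum>i<length xs. ?S (Suc i) - ?S i) = ?S (length xs) - ?S 0"
    by (rule sum_lessThan_telescope)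
  also have "?S 0 = 0"
    using L_constants[of "map (\<lambda>x. I [snd x]) xs"] assms by (simp add: o_def)
  finally show ?thesis
    using assms by (simp add: phi_eqI)
qed

theorem pi_infinity_eq_phi:
  assumes "xs \<noteq> []"
  shows "pi_infinity M xs = phi M xs"
proof -
  have "length xs = Suc n \<Longrightarrow> pi_coeff M (Suc n) xs = phi M xs" for n
  proof (induction n arbitrary: xs)
    case 0
    then show ?case by (auto simp: length_Suc_conv phi_single)
  next
    case (Suc n)
    have "precomp_Q (pi_coeff M (Suc n)) ys = precomp_Q (phi M) ys" if "length ys = Suc (Suc n)" for ys
      unfolding precomp_Q_def by (intro sum.cong refl Suc.IH) (use that in auto)
    then have "precomp_H M (precomp_Q (pi_coeff M (Suc n))) xs = precomp_H M (precomp_Q (phi M)) xs"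
      unfolding precomp_H_def using Suc.prems by (intro sum.cong refl) auto
    then show ?case
      using precomp_H_phi[of xs] Suc.prems by simp
  qed
  then show ?thesis
    using assms by (cases xs) (auto simp: pi_infinity_def)
qed

end

section \<open>Calculus of polynomials\<close>

lemma coeff_poly_primitive:
  "coeff (poly_primitive p) n = (if n = 0 then 0 else coeff p (n - 1) / of_nat n)"
proof (cases n)
  case 0
  then show ?thesis by (simp add: poly_primitive_def coeff_sum)
next
  case (Suc m)
  have "coeff (poly_primitive p) n = (\<Sum>i\<le>degree p. if i = m then coeff p m / of_nat (Suc m) else 0)"
    unfolding poly_primitive_def coeff_sum by (intro sum.cong) (auto simp: Suc)
  then show ?thesis
    by (simp add: Suc coeff_eq_0)
qed

lemma interval_calculus_poly:
  "interval_calculus (poly_functions :: ('k::field_char_0, 'k poly) interval_functions)"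
proof
  fix f g :: "'k poly" and c d e :: 'k and as
  show "simplex_int poly_functions as =
      eval_fn poly_functions (foldl (\<lambda>g a. primitive poly_functions (a * g)) 1 as) (1 :: 'k)"
    by (simp add: poly_functions_def)
  show "primitive poly_functions (deriv_fn poly_functions f) =
      f - scale_fn poly_functions (eval_fn poly_functions f 0) 1"
    by (rule poly_eqI) (auto simp: poly_functions_def coeff_poly_primitive coeff_pderiv
        poly_0_coeff_0 coeff_pCons split: nat.split simp del: of_nat_Suc)
  show "deriv_fn poly_functions (primitive poly_functions f) = f"
    by (rule poly_eqI) (simp add: poly_functions_def coeff_poly_primitive coeff_pderiv del: of_nat_Suc)
  show "primitive poly_functions (f + g) = primitive poly_functions f + primitive poly_functions g"
    by (rule poly_eqI) (simp add: poly_functions_def coeff_poly_primitive add_divide_distrib)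
  show "primitive poly_functions (scale_fn poly_functions c f) =
      scale_fn poly_functions c (primitive poly_functions f)"
    by (rule poly_eqI) (simp add: poly_functions_def coeff_poly_primitive)
  show "eval_fn poly_functions (primitive poly_functions f) 0 = 0"
    by (simp add: poly_functions_def coeff_poly_primitive poly_0_coeff_0)
  show "deriv_fn poly_functions (f * g) =
      deriv_fn poly_functions f * g + f * deriv_fn poly_functions g"
    by (simp add: poly_functions_def pderiv_mult mult.commute)
  show "deriv_fn poly_functions (coord poly_functions) = 1"
    by (simp add: poly_functions_def pderiv_pCons)
qed (simp_all add: poly_functions_def pderiv_add pderiv_smult smult_add_left smult_add_right)

section \<open>Calculus of smooth functions\<close>

lemma smooth_eval_smooth01: "smooth01 (smooth_eval f)"
  using smooth_eval by simp

lemma smooth_eval_outside: "x \<notin> {0..1} \<Longrightarrow> smooth_eval f x = 0"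
  using smooth01_outside[OF smooth_eval_smooth01] .

lemma smooth_eval_diff: "smooth_eval (f - g) x = smooth_eval f x - smooth_eval g x"
  by (simp only: diff_conv_add_uminus plus_smooth_fn.rep_eq uminus_smooth_fn.rep_eq)

lemma smooth01_continuous_on: "smooth01 f \<Longrightarrow> continuous_on {0..1} f"
  using smooth01_has_derivative DERIV_continuous_on by blast

lemma smooth01_integrable: "smooth01 f \<Longrightarrow> x \<le> 1 \<Longrightarrow> f integrable_on {0..x}"
  by (intro integrable_continuous_real continuous_on_subset[OF smooth01_continuous_on]) auto

lemma smooth_fn_eqI:
  assumes "\<And>x. x \<in> {0..1} \<Longrightarrow> smooth_eval f x = smooth_eval g x"
  shows "f = g"
proof -
  have "smooth_eval f x = smooth_eval g x" for x
    using assms smooth_eval_outside by (cases "x \<in> {0..1}") auto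
  then show ?thesis
    using smooth_eval_inject by blast
qed

lemma smooth_deriv_eqI:
  assumes "\<And>x. x \<in> {0..1} \<Longrightarrow>
    (smooth_eval f has_real_derivative smooth_eval g x) (at x within {0..1})"
  shows "smooth_deriv f = g"
  by (metis assms deriv01_eqI smooth_eval_outside smooth_deriv.rep_eq smooth_eval_inject)

lemma smooth_deriv_derivative:
  "x \<in> {0..1} \<Longrightarrow> (smooth_eval f has_real_derivative smooth_eval (smooth_deriv f) x) (at x within {0..1})"
  using smooth01_has_derivative[OF smooth_eval_smooth01] by (simp add: smooth_deriv.rep_eq)

lemma smooth_primitive_eval:
  "x \<in> {0..1} \<Longrightarrow> smooth_eval (smooth_primitive f) x = integral {0..x} (smooth_eval f)"
  by (simp add: smooth_primitive.rep_eq)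

lemma smooth_primitive_derivative:
  assumes x: "x \<in> {0..1}"
  shows "(smooth_eval (smooth_primitive f) has_real_derivative smooth_eval f x) (at x within {0..1})"
proof -
  have "((\<lambda>x. integral {0..x} (smooth_eval f)) has_real_derivative smooth_eval f x) (at x within {0..1})"
    using smooth01_continuous_on[OF smooth_eval_smooth01] x by (rule integral_has_real_derivative)
  then show ?thesis
    by (rule has_field_derivative_transform_within[where d = 1])
      (use x in \<open>auto simp: smooth_primitive_eval\<close>)
qed

section \<open>Integrals of smooth functions over the ordered simplex\<close>

lemma smooth_integrable: "integrable lborel (smooth_eval f)"
proof -
  have "set_integrable lborel {0..1} (smooth_eval f)"
    by (rule borel_integrable_atLeastAtMost'[OF smooth01_continuous_on[OF smooth_eval_smooth01]])
  moreover have "(\<lambda>x. indicator {0..1} x *\<^sub>R smooth_eval f x) = smooth_eval f"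
    using smooth_eval_outside by (fastforce simp: indicator_def)
  ultimately show ?thesis by (simp add: set_integrable_def)
qed

definition ordered_simplex :: "nat \<Rightarrow> real \<Rightarrow> (nat \<Rightarrow> real) set" where
  "ordered_simplex n s = {\<tau>. (\<forall>i<n. 0 \<le> \<tau> i \<and> \<tau> i \<le> s) \<and> (\<forall>i j. i < j \<and> j < n \<longrightarrow> \<tau> i \<le> \<tau> j)}"

lemma simplex_measurable:
  "ordered_simplex n s \<inter> space (Pi\<^sub>M {..<n} (\<lambda>_. lborel)) \<in> sets (Pi\<^sub>M {..<n} (\<lambda>_. lborel))"
proof -
  let ?P = "Pi\<^sub>M {..<n} (\<lambda>_. lborel :: real measure)"
  have comp: "(\<lambda>\<tau>. \<tau> i) \<in> borel_measurable ?P" if "i \<in> {..<n}" for i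
    using measurable_component_singleton[OF that, of "\<lambda>_. lborel :: real measure"] by simp
  have le: "Measurable.pred ?P (\<lambda>\<tau>. f \<tau> \<le> g \<tau>)"
    if "f \<in> borel_measurable ?P" "g \<in> borel_measurable ?P" for f g :: "_ \<Rightarrow> real"
    unfolding Measurable.pred_def using that by (rule borel_measurable_le)
  have "Measurable.pred ?P (\<lambda>\<tau>. (\<forall>i\<in>{..<n}. 0 \<le> \<tau> i \<and> \<tau> i \<le> s) \<and>
      (\<forall>i\<in>{..<n}. \<forall>j\<in>{..<n}. i < j \<longrightarrow> \<tau> i \<le> \<tau> j))"
    by (intro pred_intros_logic pred_intros_finite le comp borel_measurable_const) auto
  then have "{\<tau> \<in> space ?P. (\<forall>i\<in>{..<n}. 0 \<le> \<tau> i \<and> \<tau> i \<le> s) \<and>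
      (\<forall>i\<in>{..<n}. \<forall>j\<in>{..<n}. i < j \<longrightarrow> \<tau> i \<le> \<tau> j)} \<in> sets ?P"
    by (rule predE)
  moreover have "{\<tau> \<in> space ?P. (\<forall>i\<in>{..<n}. 0 \<le> \<tau> i \<and> \<tau> i \<le> s) \<and>
      (\<forall>i\<in>{..<n}. \<forall>j\<in>{..<n}. i < j \<longrightarrow> \<tau> i \<le> \<tau> j)} = ordered_simplex n s \<inter> space ?P"
    by (auto simp: ordered_simplex_def)
  ultimately show ?thesis by simp
qed

lemma simplex_integrable:
  "integrable (Pi\<^sub>M {..<n} (\<lambda>_. lborel)) (\<lambda>\<tau>. indicator (ordered_simplex n s) \<tau> * (\<Prod>i<n. smooth_eval (f i) (\<tau> i)))"
proof -
  interpret product_sigma_finite "\<lambda>_. lborel :: real measure"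
    by standard
  let ?P = "Pi\<^sub>M {..<n} (\<lambda>_. lborel :: real measure)"
  have "integrable ?P (\<lambda>\<tau>. \<Prod>i<n. smooth_eval (f i) (\<tau> i))"
    by (rule product_integrable_prod) (simp_all add: smooth_integrable)
  then have "integrable ?P (\<lambda>\<tau>. indicator (ordered_simplex n s \<inter> space ?P) \<tau> *\<^sub>R (\<Prod>i<n. smooth_eval (f i) (\<tau> i)))"
    by (rule integrable_mult_indicator[OF simplex_measurable])
  then show ?thesis
    by (rule Bochner_Integration.integrable_cong[THEN iffD1, rotated 2]) (auto simp: indicator_def)
qed

text \<open>
  By Fubini, with the last variable \<open>t\<close> integrated last: the remaining variables then range over
  the simplex with upper limit \<open>t\<close>, which is why the upper limit is arbitrary here.
\<close>

lemma simplex_integral: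
  assumes "s \<in> {0..1}"
  shows "(LINT \<tau>|Pi\<^sub>M {..<length as} (\<lambda>_. lborel).
      indicator (ordered_simplex (length as) s) \<tau> * (\<Prod>i<length as. smooth_eval (as ! i) (\<tau> i))) =
    smooth_eval (foldl (\<lambda>g a. smooth_primitive (a * g)) 1 as) s"
  using assms
proof (induction as arbitrary: s rule: rev_induct)
  case Nil
  then show ?case
    by (simp add: PiM_empty lebesgue_integral_count_space_finite ordered_simplex_def one_smooth_fn.rep_eq)
next
  case (snoc a as)
  interpret product_sigma_finite "\<lambda>_. lborel :: real measure"
    by standard
  let ?n = "length as"
  let ?g = "foldl (\<lambda>g a. smooth_primitive (a * g)) 1 as"
  let ?F = "\<lambda>\<tau>. indicator (ordered_simplex (Suc ?n) s) \<tau> * (\<Prod>i<Suc ?n. smooth_eval ((as @ [a]) ! i) (\<tau> i))"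
  let ?G = "\<lambda>t. indicator {0..s} t * smooth_eval (a * ?g) t"
  have un: "{..<Suc ?n} = {?n} \<union> {..<?n}" by auto
  have split: "?F (merge {?n} {..<?n} (x, y)) = indicator {0..s} (x ?n) * smooth_eval a (x ?n) *
      (indicator (ordered_simplex ?n (x ?n)) y * (\<Prod>i<?n. smooth_eval (as ! i) (y i)))" for x y
  proof -
    let ?\<tau> = "merge {?n} {..<?n} (x, y)"
    have \<tau>: "?\<tau> ?n = x ?n" "i < ?n \<Longrightarrow> ?\<tau> i = y i" for i
      by (simp_all add: merge_def)
    have "?\<tau> \<in> ordered_simplex (Suc ?n) s \<longleftrightarrow> x ?n \<in> {0..s} \<and> y \<in> ordered_simplex ?n (x ?n)"
      unfolding ordered_simplex_def less_Suc_eq using \<tau> by force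
    then have "indicator (ordered_simplex (Suc ?n) s) ?\<tau> =
        (indicator {0..s} (x ?n) * indicator (ordered_simplex ?n (x ?n)) y :: real)"
      by (simp add: indicator_def)
    moreover have "(\<Prod>i<Suc ?n. smooth_eval ((as @ [a]) ! i) (?\<tau> i)) =
        smooth_eval a (x ?n) * (\<Prod>i<?n. smooth_eval (as ! i) (y i))"
      using \<tau> by (simp add: nth_append mult.commute)
    ultimately show ?thesis by simp
  qed
  have inner: "(\<integral>y. ?F (merge {?n} {..<?n} (x, y)) \<partial>Pi\<^sub>M {..<?n} (\<lambda>_. lborel)) = ?G (x ?n)" for x
  proof (cases "x ?n \<in> {0..s}")
    case True
    then have "x ?n \<in> {0..1}" using snoc.prems by auto
    then show ?thesis
      unfolding split using snoc.IH[of "x ?n"] by (simp add: times_smooth_fn.rep_eq)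
  next
    case False
    then show ?thesis
      unfolding split by simp
  qed
  have meas: "?G \<in> borel_measurable lborel"
    using smooth_integrable[of "a * ?g"] by (intro borel_measurable_times) auto
  have "integrable (Pi\<^sub>M {..<Suc ?n} (\<lambda>_. lborel)) ?F"
    by (rule simplex_integrable)
  then have "integral\<^sup>L (Pi\<^sub>M {..<Suc ?n} (\<lambda>_. lborel)) ?F =
      (\<integral>x. (\<integral>y. ?F (merge {?n} {..<?n} (x, y)) \<partial>Pi\<^sub>M {..<?n} (\<lambda>_. lborel)) \<partial>Pi\<^sub>M {?n} (\<lambda>_. lborel))"
    unfolding un by (intro product_integral_fold) auto
  also have "\<dots> = (\<integral>x. ?G (x ?n) \<partial>Pi\<^sub>M {?n} (\<lambda>_. lborel))"
    by (simp only: inner)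
  also have "\<dots> = integral\<^sup>L lborel ?G"
    by (rule product_integral_singleton[OF meas])
  also have "\<dots> = integral {0..s} (smooth_eval (a * ?g))"
  proof -
    have "continuous_on {0..s} (smooth_eval (a * ?g))"
      by (rule continuous_on_subset[OF smooth01_continuous_on[OF smooth_eval_smooth01]])
        (use snoc.prems in auto)
    then have "set_integrable lborel {0..s} (smooth_eval (a * ?g))"
      by (rule borel_integrable_atLeastAtMost')
    from set_borel_integral_eq_integral(2)[OF this] show ?thesis
      by (simp add: set_lebesgue_integral_def)
  qed
  finally show ?case
    using snoc.prems by (simp add: smooth_primitive_eval)
qed

lemma smooth_simplex_int_eq:
  "smooth_simplex_int as = smooth_eval (foldl (\<lambda>g a. smooth_primitive (a * g)) 1 as) 1"
  using simplex_integral[of 1 as] by (simp add: smooth_simplex_int_def ordered_simplex_def Let_def)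

lemma interval_calculus_smooth: "interval_calculus smooth_functions"
proof
  note rep = smooth_scale.rep_eq plus_smooth_fn.rep_eq times_smooth_fn.rep_eq one_smooth_fn.rep_eq
    smooth_coord.rep_eq
  fix f g :: smooth_fn and c d e :: real and as
  show "scale_fn smooth_functions c (f + g) = scale_fn smooth_functions c f + scale_fn smooth_functions c g"
    and "scale_fn smooth_functions (c + d) f = scale_fn smooth_functions c f + scale_fn smooth_functions d f"
    and "scale_fn smooth_functions c (scale_fn smooth_functions d f) = scale_fn smooth_functions (c * d) f"
    and "scale_fn smooth_functions 1 f = f"
    and "scale_fn smooth_functions c f * g = scale_fn smooth_functions c (f * g)"
    by (auto intro!: smooth_fn_eqI simp: smooth_functions_def rep algebra_simps)
  show "eval_fn smooth_functions (f + g) e = eval_fn smooth_functions f e + eval_fn smooth_functions g e"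
    and "eval_fn smooth_functions (f * g) e = eval_fn smooth_functions f e * eval_fn smooth_functions g e"
    and "eval_fn smooth_functions (scale_fn smooth_functions c f) e = c * eval_fn smooth_functions f e"
    by (simp_all add: smooth_functions_def rep)
  show "eval_fn smooth_functions 1 e = 1" if "e = 0 \<or> e = 1"
    using that by (auto simp: smooth_functions_def rep)
  show "eval_fn smooth_functions (coord smooth_functions) 0 = 0"
    and "eval_fn smooth_functions (coord smooth_functions) 1 = 1"
    by (simp_all add: smooth_functions_def rep)
  have "smooth_deriv (f + g) = smooth_deriv f + smooth_deriv g"
    by (rule smooth_deriv_eqI) (auto simp: rep intro!: DERIV_add smooth_deriv_derivative)
  then show "deriv_fn smooth_functions (f + g) = deriv_fn smooth_functions f + deriv_fn smooth_functions g"
    by (simp add: smooth_functions_def)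
  have "smooth_deriv (smooth_scale c f) = smooth_scale c (smooth_deriv f)"
    by (rule smooth_deriv_eqI) (auto simp: rep intro!: DERIV_cmult smooth_deriv_derivative)
  then show "deriv_fn smooth_functions (scale_fn smooth_functions c f) =
      scale_fn smooth_functions c (deriv_fn smooth_functions f)"
    by (simp add: smooth_functions_def)
  have "smooth_deriv (f * g) = smooth_deriv f * g + f * smooth_deriv g"
  proof (rule smooth_deriv_eqI)
    fix x :: real assume "x \<in> {0..1}"
    then show "(smooth_eval (f * g) has_real_derivative
        smooth_eval (smooth_deriv f * g + f * smooth_deriv g) x) (at x within {0..1})"
      using DERIV_mult[OF smooth_deriv_derivative smooth_deriv_derivative, of x f g]
      by (simp add: rep mult.commute)
  qed
  then show "deriv_fn smooth_functions (f * g) =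
      deriv_fn smooth_functions f * g + f * deriv_fn smooth_functions g"
    by (simp add: smooth_functions_def)
  have "smooth_deriv smooth_coord = 1"
  proof (rule smooth_deriv_eqI)
    fix x :: real assume x: "x \<in> {0..1}"
    have "((\<lambda>x. x) has_real_derivative smooth_eval 1 x) (at x within {0..1})"
      using x by (simp add: rep)
    then show "(smooth_eval smooth_coord has_real_derivative smooth_eval 1 x) (at x within {0..1})"
      by (rule has_field_derivative_transform_within[where d = 1]) (use x in \<open>auto simp: rep\<close>)
  qed
  then show "deriv_fn smooth_functions (coord smooth_functions) = 1"
    by (simp add: smooth_functions_def)
  have "smooth_primitive (f + g) = smooth_primitive f + smooth_primitive g"
    by (rule smooth_fn_eqI)
      (simp add: rep smooth_primitive_eval integral_add smooth01_integrable smooth_eval_smooth01)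
  then show "primitive smooth_functions (f + g) = primitive smooth_functions f + primitive smooth_functions g"
    by (simp add: smooth_functions_def)
  have "smooth_primitive (smooth_scale c f) = smooth_scale c (smooth_primitive f)"
    by (rule smooth_fn_eqI) (simp add: rep smooth_primitive_eval)
  then show "primitive smooth_functions (scale_fn smooth_functions c f) =
      scale_fn smooth_functions c (primitive smooth_functions f)"
    by (simp add: smooth_functions_def)
  show "eval_fn smooth_functions (primitive smooth_functions f) 0 = 0"
    by (simp add: smooth_functions_def smooth_primitive_eval)
  have "smooth_deriv (smooth_primitive f) = f"
    by (rule smooth_deriv_eqI) (rule smooth_primitive_derivative)
  then show "deriv_fn smooth_functions (primitive smooth_functions f) = f"
    by (simp add: smooth_functions_def)
  have "smooth_primitive (smooth_deriv f) = f - smooth_scale (smooth_eval f 0) 1"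
  proof (rule smooth_fn_eqI)
    fix x :: real assume x: "x \<in> {0..1}"
    have "(smooth_eval (smooth_deriv f) has_integral smooth_eval f x - smooth_eval f 0) {0..x}"
    proof (rule fundamental_theorem_of_calculus)
      show "(smooth_eval f has_vector_derivative smooth_eval (smooth_deriv f) y) (at y within {0..x})"
        if "y \<in> {0..x}" for y
        using smooth_deriv_derivative[of y f] that x
        by (auto simp flip: has_real_derivative_iff_has_vector_derivative intro: DERIV_subset)
    qed (use x in simp)
    then have "integral {0..x} (smooth_eval (smooth_deriv f)) = smooth_eval f x - smooth_eval f 0"
      by (rule integral_unique)
    then show "smooth_eval (smooth_primitive (smooth_deriv f)) x =
        smooth_eval (f - smooth_scale (smooth_eval f 0) 1) x"
      using x by (simp add: smooth_primitive_eval smooth_eval_diff rep)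
  qed
  then show "primitive smooth_functions (deriv_fn smooth_functions f) =
      f - scale_fn smooth_functions (eval_fn smooth_functions f 0) 1"
    by (simp add: smooth_functions_def)
  show "simplex_int smooth_functions as =
      eval_fn smooth_functions (foldl (\<lambda>g a. primitive smooth_functions (a * g)) 1 as) 1"
    by (simp add: smooth_functions_def smooth_simplex_int_eq)
qed

theorem corollary2p17:
  shows "(C_infinity_morphism (Omega smooth_functions) C_inf (phi smooth_functions) \<and>
          (\<forall>xs. xs \<noteq> [] \<longrightarrow> pi_infinity smooth_functions xs = phi smooth_functions xs)) \<and>
         (C_infinity_morphism (Omega poly_functions) C_inf
            (phi (poly_functions :: ('k::field_char_0, 'k poly) interval_functions)) \<and>
          (\<forall>xs. xs \<noteq> [] \<longrightarrow>
             pi_infinity (poly_functions :: ('k, 'k poly) interval_functions) xs =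
             phi poly_functions xs))"
proof -
  interpret smooth: interval_calculus smooth_functions
    by (rule interval_calculus_smooth)
  interpret poly: interval_calculus "poly_functions :: ('k, 'k poly) interval_functions"
    by (rule interval_calculus_poly)
  show ?thesis
    using smooth.C_infinity_morphism_phi smooth.pi_infinity_eq_phi
      poly.C_infinity_morphism_phi poly.pi_infinity_eq_phi by blast
qed

end
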